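(* Let $(E,\nabla)$ be an object of $\mathbf{MC}^{\mathrm o}(R((x))/R)$ which admits a TLJ-form over $R((x))$. Then there exists a unique decomposition $\nabla=\nabla^{\mathrm{rs}}+P_\nabla$ such that the following conditions are satisfied: (i) $(E,\nabla^{\mathrm{rs}})$ belongs to $\mathbf{MC}_{\mathrm{rs}}(R((x))/R)$ and admits a TLJ-form over $R((x))$. (ii) $P_\nabla\in\mathrm{End}_{R((x))}(E)$ is diagonalizable with all eigenvalues in $x^{-1}R[x^{-1}]$. (iii) Let $(E,\nabla^{\mathrm{rs}})=\bigoplus_{\varrho\in\Sigma}(E_\varrho,\nabla_\varrho)$ be the TLJ-decomposition, equipped with a TLJ-form over $R((x))$, of $(E,\nabla^{\mathrm{rs}})$, where $\Sigma\subset R/\mathbb Z$. For each $\varrho\in\Sigma$: (a) $P_\nabla(E_\varrho)\subset E_\varrho$; (b) there exist an $R((x))$-basis $\mathbf e_\varrho$ of $E_\varrho$, an element $c_\varrho\in R$ and elements $f_{\varrho1},\dots,f_{\varrho\ell}\in x^{-1}R[x^{-1}]$ (with $\ell$ depending on $\varrho$) such that $$\mathrm{Mat}(\nabla^{\mathrm{rs}}|_{E_\varrho},\mathbf e_\varrho)=\mathrm J^\flat_{r_\varrho}(c_\varrho),\qquad \mathrm{Mat}(\nabla|_{E_\varrho},\mathbf e_\varrho)=\mathrm{diag}\big(\mathrm J^\flat_{r_{\varrho1}}(c_\varrho+f_{\varrho1}),\dots,\mathrm J^\flat_{r_{\varrho\ell}}(c_\varrho+f_{\varrho\ell})\big)$$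 for suitable positive integers $r_\varrho, r_{\varrho 1},\dots,r_{\varrho\ell}$.
   Context: $C$ is an algebraically closed field of characteristic zero; $R$ is a complete discrete valuation domain and $C$-algebra, with a fixed isomorphism $R\simeq C[[t]]$. $R((x)):=R[[x]][x^{-1}]$, with derivation $\vartheta(\sum a_nx^n)=\sum na_nx^n$. $\mathbf{MC}(R((x))/R)$: objects are pairs $(E,\nabla)$ with $E$ a finitely generated $R((x))$-module and $\nabla:E\to E$ an $R$-linear map with $\nabla(fe)=\vartheta(f)e+f\nabla(e)$; arrows are $R((x))$-linear maps commuting with the $\nabla$'s. $\mathbf{MC}^{\mathrm o}(R((x))/R)$ is the full subcategory of objects without $R$-torsion (these $E$ are free over $R((x))$). $(E,\nabla)$ is regular-singular, i.e. in $\mathbf{MC}_{\mathrm{rs}}(R((x))/R)$, if there is a finitely generated $R[[x]]$-module $\mathcal E$ with an $R$-linear $\nabla:\mathcal E\to\mathcal E$ satisfying the Leibniz rule for $\vartheta$ such that $(E,\nabla)\simeq(\mathcal E[x^{-1}],\nabla)$. Rank one connections in $\mathbf{MC}^{\mathrm o}$ are, up to isomorphism, $(R((x))\mathbf f,\ \mathbf f\mapsto f\mathbf f)$ with $f\in R((x))$, where $f,g$ give isomorphic objects iff $f-g\in\mathbb Z+xR[[x]]$; they are classified by $R[x^{-1}]/\mathbb Z$. A representative in $R((x))$ of $\varphi\in R[x^{-1}]/\mathbb Z$ is an $f\in R((x))$ whose class modulo $\mathbb Z+xR[[x]]$ is $\varphi$. $(E,\nabla)\in\mathbf{MC}^{\mathrm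 o}(R((x))/R)$ admits a TLJ-decomposition over $R((x))$ if there is a decomposition $(E,\nabla)=\bigoplus_{\varphi\in\Phi}(E_\varphi,\nabla_\varphi)$ with $\Phi\subset R[x^{-1}]/\mathbb Z$ finite and $E_\varphi$ the subconnection generated by $\ker(\nabla-f_\varphi)^{q_\varphi}$ for some representative $f_\varphi\in R((x))$ of $\varphi$ and $q_\varphi\in\mathbb N$ large enough. Elements of $\Phi$ are called characters. $(E,\nabla)$ admits a TLJ-form over $R((x))$ if moreover, for each $\varphi\in\Phi$, there is an $R((x))$-basis $\mathbf e_\varphi$ of $E_\varphi$ with $\mathrm{Mat}(\nabla_\varphi,\mathbf e_\varphi)=\mathrm J^\flat_{r_\varphi}(f_\varphi)$, where $f_\varphi$ is a representative in $R((x))$ of $\varphi$. $\mathrm{Mat}(\nabla,\mathbf e)=(a_{ij})$ means $\nabla(e_j)=\sum_i a_{ij}e_i$. $\mathrm J^\flat_r(f)$ denotes an $r\times r$ matrix with all diagonal entries $f$, all entries just below the diagonal in $\{0,1\}$ (unspecified, possibly different at each occurrence), and all other entries $0$.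
   Formalization: In (iii)(b) the 0/1 subdiagonal entries of the two matrices are required to agree, so that P is diagonal in that basis; if they may differ, uniqueness fails, e.g. for ∇ = ϑ + diag(x⁻¹, 2x⁻¹) on R((x))². *)

theory Defs
  imports
    "HOL-Computational_Algebra.Computational_Algebra"
    "Jordan_Normal_Form.VS_Connect"
begin

text \<open>
  The coefficient ring \<open>R \<simeq> C[[t]]\<close> is \<open>'c fps\<close> with \<open>'c\<close> algebraically closed of characteristic 0;
  the definitions below only use that \<open>R = 'r\<close> is a domain. Then \<open>R[[x]]\<close> is \<open>'r fps\<close> and
  \<open>R((x)) = R[[x]][1/x]\<close> is \<open>'r fls\<close>. A module over \<open>R((x))\<close> is a type \<open>'e\<close> with a scalar
  multiplication satisfying the locale predicate \<open>Modules.module\<close> of HOL; submodules are subsets.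
\<close>

definition theta_fls :: "'r::comm_ring_1 fls \<Rightarrow> 'r fls" where
  "theta_fls f = fls_X * fls_deriv f"

definition theta_fps :: "'r::comm_ring_1 fps \<Rightarrow> 'r fps" where
  "theta_fps f = fps_X * fps_deriv f"

lemma theta_fls_nth: "fls_nth (theta_fls f) n = of_int n * fls_nth f n"
  by (simp add: theta_fls_def fls_X_times_conv_shift)

lemma theta_fps_nth: "fps_nth (theta_fps f) n = of_nat n * fps_nth f n"
  by (cases n) (simp_all add: theta_fps_def)

text \<open>Objects of \<open>MC(R((x))/R)\<close> and of its full subcategory of objects without \<open>R\<close>-torsion.\<close>

definition MC :: "('r::comm_ring_1 fls \<Rightarrow> 'e::ab_group_add \<Rightarrow> 'e) \<Rightarrow> ('e \<Rightarrow> 'e) \<Rightarrow> bool" where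
  "MC scale D \<longleftrightarrow>
     Modules.module scale \<and>
     (\<exists>B. finite B \<and> Modules.module.span scale B = UNIV) \<and>
     (\<forall>v w. D (v + w) = D v + D w) \<and>
     (\<forall>r v. D (scale (fls_const r) v) = scale (fls_const r) (D v)) \<and>
     (\<forall>f v. D (scale f v) = scale (theta_fls f) v + scale f (D v))"

definition MC_tf :: "('r::comm_ring_1 fls \<Rightarrow> 'e::ab_group_add \<Rightarrow> 'e) \<Rightarrow> ('e \<Rightarrow> 'e) \<Rightarrow> bool" where
  "MC_tf scale D \<longleftrightarrow>
     MC scale D \<and> (\<forall>r v. scale (fls_const r) v = 0 \<longrightarrow> r = 0 \<or> v = 0)"

section \<open>Regular-singular connections\<close>

definition fg_module :: "('a, 'k) ring_scheme \<Rightarrow> ('a, 'm, 'l) module_scheme \<Rightarrow> bool" where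
  "fg_module A M \<longleftrightarrow> Module.module A M \<and>
     (\<exists>S. finite S \<and> S \<subseteq> carrier M \<and> (\<forall>N. Module.submodule N A M \<and> S \<subseteq> N \<longrightarrow> N = carrier M))"

text \<open>A finitely generated \<open>R[[x]]\<close>-module with an \<open>R\<close>-linear map satisfying the Leibniz rule.\<close>

definition log_model ::
  "('r::comm_ring_1 fps, 'm, 'l) module_scheme \<Rightarrow> ('m \<Rightarrow> 'm) \<Rightarrow> bool" where
  "log_model M \<delta> \<longleftrightarrow>
     fg_module class_ring M \<and>
     \<delta> \<in> carrier M \<rightarrow> carrier M \<and>
     (\<forall>m\<in>carrier M. \<forall>n\<in>carrier M. \<delta> (m \<oplus>\<^bsub>M\<^esub> n) = \<delta> m \<oplus>\<^bsub>M\<^esub> \<delta> n) \<and>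
     (\<forall>r. \<forall>m\<in>carrier M. \<delta> (fps_const r \<odot>\<^bsub>M\<^esub> m) = fps_const r \<odot>\<^bsub>M\<^esub> \<delta> m) \<and>
     (\<forall>f. \<forall>m\<in>carrier M. \<delta> (f \<odot>\<^bsub>M\<^esub> m) = (theta_fps f \<odot>\<^bsub>M\<^esub> m) \<oplus>\<^bsub>M\<^esub> (f \<odot>\<^bsub>M\<^esub> \<delta> m))"

text \<open>
  An isomorphism \<open>M[1/x] \<simeq> E\<close> of \<open>R((x))\<close>-modules, given as the \<open>R[[x]]\<close>-linear map
  \<open>\<iota> : M \<rightarrow> E\<close> which it induces on \<open>M\<close>: it sends \<open>m / x^n\<close> to \<open>x^(-n) \<iota> m\<close>. The third condition
  is injectivity on \<open>M[1/x]\<close>, the last one surjectivity (note that \<open>M\<close> may have \<open>x\<close>-torsion).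
\<close>

definition localization_at_x ::
  "('r::comm_ring_1 fps, 'm, 'l) module_scheme \<Rightarrow>
   ('r fls \<Rightarrow> 'e::ab_group_add \<Rightarrow> 'e) \<Rightarrow> ('m \<Rightarrow> 'e) \<Rightarrow> bool" where
  "localization_at_x M scale \<iota> \<longleftrightarrow>
     (\<forall>m\<in>carrier M. \<forall>n\<in>carrier M. \<iota> (m \<oplus>\<^bsub>M\<^esub> n) = \<iota> m + \<iota> n) \<and>
     (\<forall>f. \<forall>m\<in>carrier M. \<iota> (f \<odot>\<^bsub>M\<^esub> m) = scale (fps_to_fls f) (\<iota> m)) \<and>
     (\<forall>m\<in>carrier M. \<iota> m = 0 \<longrightarrow> (\<exists>n. fps_X ^ n \<odot>\<^bsub>M\<^esub> m = \<zero>\<^bsub>M\<^esub>)) \<and>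
     (\<forall>v. \<exists>m\<in>carrier M. \<exists>n. scale (fls_X ^ n) v = \<iota> m)"

text \<open>
  A finitely generated \<open>R[[x]]\<close>-module is isomorphic to a quotient of some \<open>R[[x]]^n\<close>, i.e. to one
  whose elements are cosets in \<open>nat \<Rightarrow> R[[x]]\<close>. Letting \<open>M\<close> range over the modules with
  carrier in the type \<open>(nat \<Rightarrow> 'r fps) set\<close> therefore covers all of them up to isomorphism.
  A map \<open>\<iota>\<close> as above that commutes with \<open>\<delta>\<close> and \<open>D\<close> on \<open>M\<close> commutes with them on \<open>M[1/x]\<close>, where
  \<open>\<delta>\<close> is extended by the Leibniz rule.
\<close>

definition MC_rs :: "('r::comm_ring_1 fls \<Rightarrow> 'e::ab_group_add \<Rightarrow> 'e) \<Rightarrow> ('e \<Rightarrow> 'e) \<Rightarrow> bool" where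
  "MC_rs scale D \<longleftrightarrow> MC scale D \<and>
     (\<exists>(M :: ('r fps, (nat \<Rightarrow> 'r fps) set) module) \<delta> \<iota>.
        log_model M \<delta> \<and> localization_at_x M scale \<iota> \<and>
        (\<forall>m\<in>carrier M. \<iota> (\<delta> m) = D (\<iota> m)))"

section \<open>Characters\<close>

definition Rxinv :: "'r::comm_ring_1 fls set" where  \<comment> \<open>\<open>R[x^-1]\<close>\<close>
  "Rxinv = {f. \<forall>n>0. fls_nth f n = 0}"

definition xinv_Rxinv :: "'r::comm_ring_1 fls set" where  \<comment> \<open>\<open>x^-1 R[x^-1]\<close>\<close>
  "xinv_Rxinv = {f. \<forall>n\<ge>0. fls_nth f n = 0}"

definition xRx :: "'r::comm_ring_1 fls set" where  \<comment> \<open>\<open>x R[[x]]\<close>\<close>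
  "xRx = {f. \<forall>n\<le>0. fls_nth f n = 0}"

definition Z_coset :: "'r::comm_ring_1 fls \<Rightarrow> 'r fls set" where
  "Z_coset p = {p + of_int n | n. True}"

definition characters :: "'r::comm_ring_1 fls set set" where  \<comment> \<open>\<open>R[x^-1] / Z\<close>\<close>
  "characters = Z_coset ` Rxinv"

definition const_characters :: "'r::comm_ring_1 fls set set" where  \<comment> \<open>\<open>R / Z\<close>\<close>
  "const_characters = Z_coset ` range fls_const"

text \<open>The class of \<open>f\<close> modulo \<open>Z + x R[[x]]\<close> is \<open>\<phi>\<close>; as \<open>\<phi>\<close> is already a coset of \<open>Z\<close>, only
  \<open>x R[[x]]\<close> is left to divide out.\<close>

definition represents :: "'r::comm_ring_1 fls \<Rightarrow> 'r fls set \<Rightarrow> bool" where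
  "represents f \<phi> \<longleftrightarrow> (\<exists>p\<in>\<phi>. f - p \<in> xRx)"

section \<open>TLJ-decompositions and TLJ-forms\<close>

definition subconnection ::
  "('r::comm_ring_1 fls \<Rightarrow> 'e::ab_group_add \<Rightarrow> 'e) \<Rightarrow> ('e \<Rightarrow> 'e) \<Rightarrow> 'e set \<Rightarrow> bool" where
  "subconnection scale D W \<longleftrightarrow> Modules.module.subspace scale W \<and> D ` W \<subseteq> W"

definition ker_power ::
  "('r::comm_ring_1 fls \<Rightarrow> 'e::ab_group_add \<Rightarrow> 'e) \<Rightarrow> ('e \<Rightarrow> 'e) \<Rightarrow> 'r fls \<Rightarrow> nat \<Rightarrow> 'e set" where
  "ker_power scale D f q = {v. ((\<lambda>w. D w - scale f w) ^^ q) v = 0}"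

definition direct_sum_family :: "'i set \<Rightarrow> ('i \<Rightarrow> 'e::ab_group_add set) \<Rightarrow> bool" where
  "direct_sum_family I W \<longleftrightarrow>
     (\<forall>v. \<exists>!w. (\<forall>i\<in>I. w i \<in> W i) \<and> (\<forall>i. i \<notin> I \<longrightarrow> w i = 0) \<and> v = (\<Sum>i\<in>I. w i))"

text \<open>
  ``\<open>q\<close> large enough'' means: for all \<open>q\<close> from some point on. The summands are required to be nonzero,
  so that \<open>\<Phi>\<close> consists of the characters that actually occur.
\<close>

definition TLJ_decomposition ::
  "('r::comm_ring_1 fls \<Rightarrow> 'e::ab_group_add \<Rightarrow> 'e) \<Rightarrow> ('e \<Rightarrow> 'e) \<Rightarrow>
   'r fls set set \<Rightarrow> ('r fls set \<Rightarrow> 'e set) \<Rightarrow> bool" where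
  "TLJ_decomposition scale D \<Phi> E \<longleftrightarrow>
     finite \<Phi> \<and> \<Phi> \<subseteq> characters \<and> direct_sum_family \<Phi> E \<and>
     (\<forall>\<phi>\<in>\<Phi>. E \<phi> \<noteq> {0} \<and>
        (\<exists>f. represents f \<phi> \<and>
           (\<exists>q0. \<forall>q\<ge>q0. E \<phi> = subconnection scale D hull ker_power scale D f q)))"

definition ordered_basis ::
  "('r::comm_ring_1 fls \<Rightarrow> 'e::ab_group_add \<Rightarrow> 'e) \<Rightarrow> 'e set \<Rightarrow> 'e list \<Rightarrow> bool" where
  "ordered_basis scale W es \<longleftrightarrow>
     distinct es \<and> \<not> Modules.module.dependent scale (set es) \<and>
     Modules.module.span scale (set es) = W"

definition has_Mat ::
  "('r::comm_ring_1 fls \<Rightarrow> 'e::ab_group_add \<Rightarrow> 'e) \<Rightarrow> ('e \<Rightarrow> 'e) \<Rightarrow> 'e list \<Rightarrow> 'r fls mat \<Rightarrow> bool" where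
  "has_Mat scale D es A \<longleftrightarrow>
     A \<in> carrier_mat (length es) (length es) \<and>
     (\<forall>j<length es. D (es ! j) = (\<Sum>i<length es. scale (A $$ (i, j)) (es ! i)))"

definition is_Jflat :: "nat \<Rightarrow> 'a::zero_neq_one \<Rightarrow> 'a mat \<Rightarrow> bool" where
  "is_Jflat r f A \<longleftrightarrow> A \<in> carrier_mat r r \<and>
     (\<forall>i<r. \<forall>j<r.
        if i = j then A $$ (i, j) = f
        else if i = Suc j then A $$ (i, j) \<in> {0, 1}
        else A $$ (i, j) = 0)"

definition TLJ_form ::
  "('r::comm_ring_1 fls \<Rightarrow> 'e::ab_group_add \<Rightarrow> 'e) \<Rightarrow> ('e \<Rightarrow> 'e) \<Rightarrow>
   'r fls set set \<Rightarrow> ('r fls set \<Rightarrow> 'e set) \<Rightarrow> bool" where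
  "TLJ_form scale D \<Phi> E \<longleftrightarrow>
     TLJ_decomposition scale D \<Phi> E \<and>
     (\<forall>\<phi>\<in>\<Phi>. \<exists>es f A. ordered_basis scale (E \<phi>) es \<and> represents f \<phi> \<and>
        is_Jflat (length es) f A \<and> has_Mat scale D es A)"

definition admits_TLJ_form ::
  "('r::comm_ring_1 fls \<Rightarrow> 'e::ab_group_add \<Rightarrow> 'e) \<Rightarrow> ('e \<Rightarrow> 'e) \<Rightarrow> bool" where
  "admits_TLJ_form scale D \<longleftrightarrow> (\<exists>\<Phi> E. TLJ_form scale D \<Phi> E)"

section \<open>The decomposition into regular-singular part and diagonalizable part\<close>

definition diagonalizable_end ::
  "('r::comm_ring_1 fls \<Rightarrow> 'e::ab_group_add \<Rightarrow> 'e) \<Rightarrow> ('e \<Rightarrow> 'e) \<Rightarrow> bool" where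
  "diagonalizable_end scale P \<longleftrightarrow>
     (\<exists>es. ordered_basis scale UNIV es \<and> (\<forall>e\<in>set es. \<exists>c. P e = scale c e))"

definition eigenvalue_end ::
  "('r::comm_ring_1 fls \<Rightarrow> 'e::ab_group_add \<Rightarrow> 'e) \<Rightarrow> ('e \<Rightarrow> 'e) \<Rightarrow> 'r fls \<Rightarrow> bool" where
  "eigenvalue_end scale P c \<longleftrightarrow> (\<exists>v. v \<noteq> 0 \<and> P v = scale c v)"

text \<open>
  The simultaneous matrix form of \<open>D0\<close> (regular-singular) and \<open>D\<close> on \<open>W\<close>:
  \<open>Mat(D0) = J(c)\<close> and \<open>Mat(D) = diag(J(c + f_1), ..., J(c + f_l))\<close> in one and the same basis.
  The last conjunct says that the unspecified entries 0 or 1 below the diagonal agree in the two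
  matrices, so that \<open>D - D0\<close> is diagonal in this basis. If those entries could be chosen
  independently, the decomposition would not be unique: for \<open>D = diag(f, g)\<close> with
  \<open>f = x^-1\<close> and \<open>g = 2 x^-1\<close>, besides \<open>D0 = 0\<close>, \<open>P = diag(f, g)\<close> (matrix parts) one could take
  \<open>D0 = J(0)\<close> with entry 1 below the diagonal and \<open>P = D - D0\<close>, which is diagonalizable with
  eigenvalues \<open>f\<close> and \<open>g\<close> because \<open>f - g\<close> is a unit of \<open>R((x))\<close>.
\<close>

definition joint_Jflat_form ::
  "('r::comm_ring_1 fls \<Rightarrow> 'e::ab_group_add \<Rightarrow> 'e) \<Rightarrow> ('e \<Rightarrow> 'e) \<Rightarrow> ('e \<Rightarrow> 'e) \<Rightarrow> 'e set \<Rightarrow>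
   'e list \<Rightarrow> 'r \<Rightarrow> 'r fls list \<Rightarrow> nat list \<Rightarrow> bool" where
  "joint_Jflat_form scale D0 D W es c fs rs \<longleftrightarrow>
     ordered_basis scale W es \<and> length es > 0 \<and>
     set fs \<subseteq> xinv_Rxinv \<and> length rs = length fs \<and> (\<forall>r\<in>set rs. r > 0) \<and>
     (\<exists>A Bs.
        is_Jflat (length es) (fls_const c) A \<and> has_Mat scale D0 es A \<and>
        length Bs = length fs \<and>
        (\<forall>i<length fs. is_Jflat (rs ! i) (fls_const c + fs ! i) (Bs ! i)) \<and>
        has_Mat scale D es (diag_block_mat Bs) \<and>
        (\<forall>i<length es. \<forall>j<length es. i \<noteq> j \<longrightarrow> A $$ (i, j) = diag_block_mat Bs $$ (i, j)))"

end

theory Submission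
  imports Defs
begin

text \<open>
  Everything rests on the equation \<open>\<vartheta> u = h u\<close> over \<open>R((x))\<close>. Looking at the lowest coefficient of a
  nonzero solution shows \<open>h \<in> \<int> + x R[[x]]\<close>
  (\<open>gauge_equiv_if_theta_eigenvector\<close>); conversely, for such an \<open>h\<close> there is a solution which is
  a unit of \<open>R((x))\<close>, because the positive integers are invertible in \<open>R\<close>
  (\<open>theta_eigenvector_unit\<close>).

  Let \<open>e\<^sub>1, \<dots>, e\<^sub>n\<close> be a basis in which the matrix of a connection \<open>D\<close> consists of Jordan
  blocks, with diagonal entries \<open>d\<^sub>1, \<dots>, d\<^sub>n\<close>. The coordinates of a vector \<open>v\<close> killed by a power
  of \<open>D - f\<close> satisfy a triangular system whose diagonal part is \<open>\<vartheta> + d\<^sub>i - f\<close>, and this operator is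
  injective unless \<open>d\<^sub>i - f \<in> \<int> + x R[[x]]\<close>. Hence \<open>v\<close> is a combination of those \<open>e\<^sub>i\<close> whose \<open>d\<^sub>i\<close>
  defines the same character as \<open>f\<close> (\<open>ker_power_subset_span\<close>). This one fact gives both halves
  of uniqueness.

  \<^item> The TLJ-decomposition of \<open>D\<close> is unique (\<open>TLJ_form_unique\<close>): a character that occurs in one
    TLJ-form occurs in every other, and its summand does not depend on the chosen
    representative, since a change of representative multiplies the kernels by a unit.

  \<^item> \<open>P\<close> is determined by \<open>\<nabla>\<close> (\<open>polar_part_unique\<close>): by condition (iii) there is a basis
    in which \<open>\<nabla>\<close> has Jordan blocks with diagonal entries \<open>c + g\<close>, where \<open>c \<in> R\<close>,
    \<open>g \<in> x\<^sup>-\<^sup>1R[x\<^sup>-\<^sup>1]\<close>, and \<open>P\<close> multiplies the corresponding basis vector by \<open>g\<close>. If \<open>P'\<close> and a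
    second basis also have these properties, every vector of the second basis with entry \<open>c' + g'\<close>
    is killed by a power of \<open>\<nabla> - (c' + g')\<close>, so it is a combination of vectors of the first with \<open>g = g'\<close>,
    where \<open>P\<close> also acts as \<open>g'\<close>.

  For existence, multiplying the basis of each summand \<open>E\<^sub>\<phi>\<close> by a unit turns its Jordan matrix
  into one with diagonal entry \<open>c\<^sub>\<phi> + g\<^sub>\<phi>\<close> exactly, where \<open>c\<^sub>\<phi> \<in> R\<close> is moreover the same for all \<open>\<phi>\<close>
  whose constant terms agree modulo \<open>\<int>\<close>. Let \<open>P\<close> act as \<open>g\<^sub>\<phi>\<close> on \<open>E\<^sub>\<phi>\<close> and put \<open>\<nabla>\<^sup>r\<^sup>s = \<nabla> - P\<close>. The
  \<open>R[[x]]\<close>-span of the basis is a lattice stable under \<open>\<nabla>\<^sup>r\<^sup>s\<close>, so \<open>\<nabla>\<^sup>r\<^sup>s\<close> is regular-singular; its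
  TLJ-summands are obtained by collecting the \<open>E\<^sub>\<phi>\<close> with equal \<open>c\<^sub>\<phi>\<close>, and the collected bases are
  the simultaneous ones demanded by (iii). By uniqueness of the TLJ-decomposition there
  is no other TLJ-form of \<open>\<nabla>\<^sup>r\<^sup>s\<close> to be checked.
\<close>

section \<open>The equation \<open>\<vartheta> u = h u\<close> over \<open>R((x))\<close>\<close>

lemma theta_fls_mult: "theta_fls (f * g) = theta_fls f * g + f * theta_fls g"
  by (simp add: theta_fls_def algebra_simps)

lemma theta_fls_fps_to_fls: "theta_fls (fps_to_fls F) = fps_to_fls (theta_fps F)"
  by (simp add: theta_fls_def theta_fps_def fls_deriv_fps_to_fls fls_times_fps_to_fls)

lemma theta_fls_const [simp]: "theta_fls (fls_const c) = 0"
  by (simp add: theta_fls_def)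

lemma theta_fls_X_intpow: "theta_fls (fls_X_intpow n) = of_int n * fls_X_intpow n"
  by (rule fls_eqI) (auto simp: theta_fls_nth fls_of_int)

text \<open>
  Congruence modulo \<open>\<int> + x R[[x]]\<close>, that is, isomorphism of the rank one connections defined by
  \<open>f\<close> and \<open>g\<close>.
\<close>

definition gauge_equiv :: "'r::comm_ring_1 fls \<Rightarrow> 'r fls \<Rightarrow> bool" where
  "gauge_equiv f g \<longleftrightarrow> (\<exists>n::int. f - g - of_int n \<in> xRx)"

lemma xRx_add: "f \<in> xRx \<Longrightarrow> g \<in> xRx \<Longrightarrow> f + g \<in> xRx"
  and xRx_uminus: "f \<in> xRx \<Longrightarrow> - f \<in> xRx"
  and zero_in_xRx [simp]: "0 \<in> xRx"
  by (simp_all add: xRx_def)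

lemma gauge_equiv_refl: "gauge_equiv f f"
  by (auto simp: gauge_equiv_def intro: exI[of _ 0])

lemma gauge_equiv_sym: assumes "gauge_equiv f g" shows "gauge_equiv g f"
proof -
  obtain n where "f - g - of_int n \<in> xRx" using assms by (auto simp: gauge_equiv_def)
  from xRx_uminus[OF this] have "g - f - of_int (- n) \<in> xRx" by (simp add: algebra_simps)
  then show ?thesis unfolding gauge_equiv_def by blast
qed

lemma gauge_equiv_trans:
  assumes "gauge_equiv f g" "gauge_equiv g h" shows "gauge_equiv f h"
proof -
  obtain n m where "f - g - of_int n \<in> xRx" "g - h - of_int m \<in> xRx"
    using assms by (auto simp: gauge_equiv_def)
  from xRx_add[OF this] have "f - h - of_int (n + m) \<in> xRx" by (simp add: algebra_simps)
  then show ?thesis unfolding gauge_equiv_def by blast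
qed

lemma gauge_equiv_0_diff: "gauge_equiv (f - g) 0 \<longleftrightarrow> gauge_equiv f g"
  by (simp add: gauge_equiv_def)

lemma fls_of_int_nth': "fls_nth (of_int n :: 'r::comm_ring_1 fls) k = (if k = 0 then of_int n else 0)"
  by (simp add: fls_of_int)

text \<open>
  Let \<open>n\<close> be the order of \<open>u\<close>. The left side has order at least \<open>n\<close>, so \<open>h\<close> cannot have a pole,
  as \<open>R\<close> is a domain; and comparing the coefficients of \<open>x\<^sup>n\<close> gives \<open>n u\<^sub>n = h\<^sub>0 u\<^sub>n\<close>, hence \<open>h\<^sub>0 = n\<close>.
\<close>

lemma gauge_equiv_if_theta_eigenvector:
  fixes u h :: "'r::idom fls"
  assumes eq: "theta_fls u = h * u" and u: "u \<noteq> 0"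
  shows "gauge_equiv h 0"
proof (cases "h = 0")
  case True
  then show ?thesis by (simp add: gauge_equiv_refl)
next
  case False
  let ?n = "fls_subdegree u" and ?m = "fls_subdegree h"
  have lead: "fls_nth (h * u) (?m + ?n) = fls_nth h ?m * fls_nth u ?n"
    by (simp add: fls_times_base)
  have "?m \<ge> 0"
  proof (rule ccontr)
    assume "\<not> ?m \<ge> 0"
    then have "fls_nth (theta_fls u) (?m + ?n) = 0"
      by (simp add: theta_fls_nth fls_eq0_below_subdegree)
    with lead eq u False show False by (simp add: nth_fls_subdegree_nonzero)
  qed
  have "fls_nth (h * u) ?n = fls_nth h 0 * fls_nth u ?n"
  proof (cases "?m = 0")
    case True
    with lead show ?thesis by simp
  next
    case m: False
    with \<open>?m \<ge> 0\<close> have "?n < fls_subdegree (h * u)" using u False by simp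
    then show ?thesis using m \<open>?m \<ge> 0\<close> by (simp add: fls_eq0_below_subdegree del: fls_subdegree_mult)
  qed
  with eq have "(of_int ?n - fls_nth h 0) * fls_nth u ?n = 0"
    by (simp add: theta_fls_nth algebra_simps flip: eq)
  then have "fls_nth h 0 = of_int ?n" using u by (simp add: nth_fls_subdegree_nonzero)
  then have "h - 0 - of_int ?n \<in> xRx"
    using \<open>?m \<ge> 0\<close> by (auto simp: xRx_def fls_of_int_nth' fls_eq0_below_subdegree)
  then show ?thesis unfolding gauge_equiv_def by blast
qed

text \<open>
  The recursion \<open>n u\<^sub>n = \<Sum>\<^sub>k\<^sub><\<^sub>n u\<^sub>k y\<^sub>n\<^sub>-\<^sub>k\<close> with \<open>u\<^sub>0 = 1\<close>, which expresses \<open>\<vartheta> u = y u\<close> for a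
  power series \<open>y\<close> without constant term. The chosen \<open>z\<close> is the inverse of \<open>n\<close> in \<open>R\<close>.
\<close>

fun gauge_coeff :: "(nat \<Rightarrow> 'r::comm_ring_1) \<Rightarrow> nat \<Rightarrow> 'r" where
  "gauge_coeff y n =
     (if n = 0 then 1
      else (SOME z. of_nat n * z = 1) * (\<Sum>k<n. gauge_coeff y k * y (n - k)))"
declare gauge_coeff.simps [simp del]

lemma theta_fps_gauge_coeff:
  fixes Y :: "'r::comm_ring_1 fps"
  assumes Q: "\<And>n. n > 0 \<Longrightarrow> (of_nat n :: 'r) dvd 1" and Y: "fps_nth Y 0 = 0"
  shows "theta_fps (Abs_fps (gauge_coeff (fps_nth Y))) = Y * Abs_fps (gauge_coeff (fps_nth Y))"
    (is "theta_fps ?F = _")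
proof (rule fps_ext)
  fix n
  show "fps_nth (theta_fps ?F) n = fps_nth (Y * ?F) n"
  proof (cases "n = 0")
    case True
    then show ?thesis by (simp add: theta_fps_nth Y)
  next
    case False
    from Q[of n] False obtain z where "(of_nat n :: 'r) * z = 1" by (metis dvdE gr0I)
    then have z: "(of_nat n :: 'r) * (SOME z. of_nat n * z = 1) = 1" by (rule someI)
    have "fps_nth (theta_fps ?F) n =
      (of_nat n * (SOME z. of_nat n * z = 1)) * (\<Sum>k<n. gauge_coeff (fps_nth Y) k * fps_nth Y (n - k))"
      using False by (simp add: theta_fps_nth gauge_coeff.simps[of _ n] mult.assoc)
    also have "\<dots> = (\<Sum>k<n. fps_nth ?F k * fps_nth Y (n - k))" by (simp add: z)
    also have "\<dots> = (\<Sum>k=0..n. fps_nth ?F k * fps_nth Y (n - k))"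
      using Y by (simp add: atLeast0AtMost flip: lessThan_Suc_atMost)
    finally show ?thesis by (simp add: fps_mult_nth mult.commute[of Y])
  qed
qed

text \<open>
  Write \<open>h = m + y\<close> with \<open>m \<in> \<int>\<close> and \<open>y \<in> x R[[x]]\<close>. A solution is \<open>x\<^sup>m\<close> times a power series \<open>F\<close>
  with \<open>\<vartheta> F = y F\<close>; its inverse comes from the series \<open>G\<close> for \<open>- y\<close>, because \<open>\<vartheta> (F G) = 0\<close> forces
  \<open>F G\<close> to be the constant \<open>1\<close>. That \<open>R\<close> is a \<open>\<rat>\<close>-algebra is expressed by divisibility in \<open>R\<close>.
\<close>

lemma theta_eigenvector_unit:
  fixes h :: "'r::comm_ring_1 fls"
  assumes Q: "\<And>n. n > 0 \<Longrightarrow> (of_nat n :: 'r) dvd 1" and h: "gauge_equiv h 0"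
  obtains w w' where "w * w' = 1" "theta_fls w = h * w"
proof -
  from h obtain m where m: "h - of_int m \<in> xRx" by (auto simp: gauge_equiv_def)
  define Y where "Y = Abs_fps (\<lambda>k. fls_nth (h - of_int m) (int k))"
  have Y0: "fps_nth Y 0 = 0" using m by (simp add: Y_def xRx_def)
  have hY: "h = of_int m + fps_to_fls Y"
  proof (rule fls_eqI)
    fix k show "fls_nth h k = fls_nth (of_int m + fps_to_fls Y) k"
      using m by (cases "k > 0") (auto simp: Y_def xRx_def)
  qed
  define F where "F = Abs_fps (gauge_coeff (fps_nth Y))"
  define G where "G = Abs_fps (gauge_coeff (fps_nth (- Y)))"
  have F: "theta_fps F = Y * F" unfolding F_def by (rule theta_fps_gauge_coeff[OF Q Y0])
  have G: "theta_fps G = - Y * G" unfolding G_def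
    by (rule theta_fps_gauge_coeff[OF Q]) (use Y0 in auto)
  have "theta_fps (F * G) = theta_fps F * G + F * theta_fps G"
    by (simp add: theta_fps_def algebra_simps)
  then have FG0: "theta_fps (F * G) = 0" by (simp add: F G algebra_simps)
  have FG: "F * G = 1"
  proof (rule fps_ext)
    fix n
    show "fps_nth (F * G) n = fps_nth 1 n"
    proof (cases "n = 0")
      case True
      then show ?thesis by (simp add: F_def G_def gauge_coeff.simps)
    next
      case False
      with Q[of n] obtain z where "1 = (of_nat n :: 'r) * z" by (metis dvdE gr0I)
      moreover have "of_nat n * fps_nth (F * G) n = 0"
        using FG0 by (metis theta_fps_nth fps_zero_nth)
      ultimately have "fps_nth (F * G) n = 0"
        by (metis mult.commute mult.left_commute mult_1 mult_zero_right)
      then show ?thesis using False by simp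
    qed
  qed
  show thesis
  proof
    show "(fls_X_intpow m * fps_to_fls F) * (fls_X_intpow (-m) * fps_to_fls G) = 1"
    proof -
      have "(fls_X_intpow m * fps_to_fls F) * (fls_X_intpow (-m) * fps_to_fls G)
        = (fls_X_intpow m * fls_X_intpow (-m)) * fps_to_fls (F * G)"
        by (simp add: fls_times_fps_to_fls algebra_simps)
      also have "\<dots> = 1"
        unfolding FG fls_X_intpow_times_fls_X_intpow by simp
      finally show ?thesis .
    qed
    show "theta_fls (fls_X_intpow m * fps_to_fls F) = h * (fls_X_intpow m * fps_to_fls F)"
      by (simp add: theta_fls_mult theta_fls_X_intpow theta_fls_fps_to_fls F hY
          fls_times_fps_to_fls algebra_simps)
  qed
qed

text \<open>
  An element of \<open>\<int> + x R[[x]]\<close> has no polar part and an integral constant term.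
\<close>

lemma gauge_equiv_const_polar:
  fixes c c' :: "'r::comm_ring_1"
  assumes "g \<in> xinv_Rxinv" "g' \<in> xinv_Rxinv"
    and "gauge_equiv (fls_const c + g) (fls_const c' + g')"
  shows "g = g'" and "\<exists>n::int. c = c' + of_int n"
proof -
  obtain n where n: "fls_const c + g - (fls_const c' + g') - of_int n \<in> xRx"
    using assms(3) by (auto simp: gauge_equiv_def)
  then have *: "fls_nth (fls_const c + g - (fls_const c' + g') - of_int n) k = 0" if "k \<le> 0" for k
    using that by (simp add: xRx_def)
  show "g = g'"
  proof (rule fls_eqI)
    fix k show "fls_nth g k = fls_nth g' k"
      using *[of k] assms(1,2) by (cases "k < 0") (auto simp: fls_of_int_nth' xinv_Rxinv_def)
  qed
  have "c = c' + of_int n"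
    using *[of 0] assms(1,2) by (auto simp: fls_of_int_nth' xinv_Rxinv_def algebra_simps)
  then show "\<exists>n::int. c = c' + of_int n" by blast
qed

lemma represents_gauge_equiv:
  "represents f (Z_coset p) \<longleftrightarrow> gauge_equiv f p"
  by (auto simp: represents_def Z_coset_def gauge_equiv_def algebra_simps)

lemma Z_coset_eqI:
  assumes p: "p = q + of_int n" shows "Z_coset p = Z_coset q"
proof -
  have "p + of_int k = q + of_int (n + k)" for k using p by (simp add: algebra_simps)
  moreover have "q + of_int k = p + of_int (k - n)" for k using p by (simp add: algebra_simps)
  ultimately show ?thesis unfolding Z_coset_def by blast
qed

lemma gauge_equiv_imp_Z_coset_eq:
  assumes "p \<in> Rxinv" "q \<in> Rxinv" "gauge_equiv p q" shows "Z_coset p = Z_coset q"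
proof -
  obtain n where n: "p - q - of_int n \<in> xRx" using assms(3) by (auto simp: gauge_equiv_def)
  have "p = q + of_int n"
  proof (rule fls_eqI)
    fix k show "fls_nth p k = fls_nth (q + of_int n) k"
      using n assms(1,2) by (cases "k > 0") (auto simp: Rxinv_def xRx_def fls_of_int_nth' algebra_simps)
  qed
  then show ?thesis by (rule Z_coset_eqI)
qed

text \<open>
  Elements of \<open>R[x\<^sup>-\<^sup>1]\<close> that are congruent modulo \<open>\<int> + x R[[x]]\<close> differ by an integer, since
  \<open>R[x\<^sup>-\<^sup>1]\<close> meets \<open>x R[[x]]\<close> only in \<open>0\<close>.
\<close>

lemma character_eq_iff_gauge_equiv:
  assumes "\<phi> \<in> characters" "\<psi> \<in> characters" "represents f \<phi>" "represents g \<psi>"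
  shows "\<phi> = \<psi> \<longleftrightarrow> gauge_equiv f g"
proof -
  obtain p q where pq: "\<phi> = Z_coset p" "p \<in> Rxinv" "\<psi> = Z_coset q" "q \<in> Rxinv"
    using assms(1,2) by (auto simp: characters_def)
  have fp: "gauge_equiv f p" and gq: "gauge_equiv g q"
    using assms(3,4) pq by (simp_all add: represents_gauge_equiv)
  show ?thesis
  proof
    assume "\<phi> = \<psi>"
    then have "gauge_equiv g p" using assms(4) pq by (metis represents_gauge_equiv)
    then show "gauge_equiv f g" using fp gauge_equiv_sym gauge_equiv_trans by blast
  next
    assume "gauge_equiv f g"
    then have "gauge_equiv p q" using fp gq gauge_equiv_sym gauge_equiv_trans by blast
    then show "\<phi> = \<psi>" using gauge_equiv_imp_Z_coset_eq pq by metis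
  qed
qed

section \<open>Bases and direct sums over \<open>R((x))\<close>\<close>

lemma nth_concat_map:
  assumes "i < length (concat (map es xs))" "\<And>x. x \<in> set xs \<Longrightarrow> length (ds x) = length (es x)"
  shows "\<exists>x\<in>set xs. \<exists>j<length (es x). concat (map es xs) ! i = es x ! j \<and> concat (map ds xs) ! i = ds x ! j"
  using assms
proof (induction xs arbitrary: i)
  case (Cons x xs)
  show ?case
  proof (cases "i < length (es x)")
    case True
    then show ?thesis using Cons.prems(2)[of x] by (auto simp: nth_append)
  next
    case False
    then have "i - length (es x) < length (concat (map es xs))" using Cons.prems(1) by auto
    from Cons.IH[OF this] Cons.prems(2) obtain y j where "y \<in> set xs" "j < length (es y)"
      "concat (map es xs) ! (i - length (es x)) = es y ! j"
      "concat (map ds xs) ! (i - length (es x)) = ds y ! j" by auto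
    then show ?thesis using False Cons.prems(2)[of x] by (auto simp: nth_append)
  qed
qed simp

lemma distinct_concat_map_disjoint:
  assumes "distinct (concat (map L xs))" "i \<in> set xs" "j \<in> set xs" "i \<noteq> j"
  shows "set (L i) \<inter> set (L j) = {}"
  using assms by (induction xs) auto

lemma distinct_concat_map_filter:
  "distinct (concat (map L xs)) \<Longrightarrow> distinct (concat (map L (filter p xs)))"
  by (induction xs) auto

locale laurent_module = Modules.module scale
  for scale :: "'r::idom fls \<Rightarrow> 'e::ab_group_add \<Rightarrow> 'e"
begin

lemma list_coeffs_in_span:
  assumes "v \<in> span (set es)"
  obtains u where "v = (\<Sum>i<length es. scale (u i) (es ! i))"
proof -
  have "\<exists>u. v = (\<Sum>i<length es. scale (u i) (es ! i))"
    using assms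
  proof (induction es arbitrary: v)
    case Nil
    then show ?case by simp
  next
    case (Cons e es)
    then obtain k where "v - scale k e \<in> span (set es)"
      by (auto simp: span_insert)
    from Cons.IH[OF this] obtain u where u: "v - scale k e = (\<Sum>i<length es. scale (u i) (es ! i))"
      by blast
    have "v = (\<Sum>i<length (e # es). scale (case i of 0 \<Rightarrow> k | Suc j \<Rightarrow> u j) ((e # es) ! i))"
      using u by (simp add: sum.lessThan_Suc_shift algebra_simps del: sum.lessThan_Suc)
    then show ?case by blast
  qed
  then show thesis using that by blast
qed

lemma ordered_basis_coeff_eq_0:
  assumes "ordered_basis scale W es" and "(\<Sum>i<length es. scale (u i) (es ! i)) = 0"
    and "i < length es"
  shows "u i = 0"
proof -
  have d: "distinct es" "independent (set es)" using assms(1) by (auto simp: ordered_basis_def)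
  have bij: "bij_betw ((!) es) {..<length es} (set es)" using d(1) by (simp add: bij_betw_nth)
  define U where "U b = u (inv_into {..<length es} ((!) es) b)" for b
  have U: "U (es ! j) = u j" if "j < length es" for j
    using that bij by (simp add: U_def bij_betw_inv_into_left)
  have "(\<Sum>b\<in>set es. scale (U b) b) = (\<Sum>j<length es. scale (U (es ! j)) (es ! j))"
    by (rule sum.reindex_bij_betw[OF bij, symmetric])
  also have "\<dots> = 0" using assms(2) U by simp
  finally have "U (es ! i) = 0"
    using independentD[OF d(2), of "set es" U "es ! i"] assms(3) by simp
  with U assms(3) show ?thesis by simp
qed

lemma ordered_basisI:
  assumes span: "span (set es) = W"
    and coeff: "\<And>u i. (\<Sum>j<length es. scale (u j) (es ! j)) = 0 \<Longrightarrow> i < length es \<Longrightarrow> u i = 0"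
  shows "ordered_basis scale W es"
proof -
  have "distinct es" unfolding distinct_conv_nth
  proof (intro allI impI notI)
    fix i j assume ij: "i < length es" "j < length es" "i \<noteq> j" "es ! i = es ! j"
    let ?u = "\<lambda>k. if k = i then 1 else if k = j then - 1 else 0 :: 'r fls"
    have "(\<Sum>k<length es. scale (?u k) (es ! k)) = (\<Sum>k\<in>{i, j}. scale (?u k) (es ! k))"
      by (rule sum.mono_neutral_right) (use ij in auto)
    also have "\<dots> = 0" using ij by simp
    finally show False using coeff[of ?u i] ij(1) by simp
  qed
  then have bij: "bij_betw ((!) es) {..<length es} (set es)" by (simp add: bij_betw_nth)
  have "independent (set es)"
  proof
    assume "dependent (set es)"
    then obtain U b where U: "(\<Sum>b\<in>set es. scale (U b) b) = 0" "b \<in> set es" "U b \<noteq> 0"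
      by (auto simp: dependent_finite)
    obtain i where i: "i < length es" "b = es ! i" using U(2) by (metis in_set_conv_nth)
    have "(\<Sum>j<length es. scale (U (es ! j)) (es ! j)) = 0"
      using sum.reindex_bij_betw[OF bij, of "\<lambda>b. scale (U b) b"] U(1) by simp
    from coeff[OF this i(1)] U(3) i(2) show False by simp
  qed
  with \<open>distinct es\<close> span show ?thesis by (simp add: ordered_basis_def)
qed

lemma ordered_basis_map_unit:
  assumes es: "ordered_basis scale W es" and w: "w * w' = 1"
  shows "ordered_basis scale W (map (scale w) es)"
proof (rule ordered_basisI)
  have w': "scale w' (scale w v) = v" for v using w by (simp add: mult.commute)
  have W: "span (set es) = W" using es by (simp add: ordered_basis_def)
  have "scale w ` set es \<subseteq> span (set es)" by (auto intro: span_scale span_base)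
  moreover have "b \<in> span (scale w ` set es)" if "b \<in> set es" for b
    using span_scale[OF span_base, of "scale w b" "scale w ` set es" w'] w'[of b] that by simp
  ultimately show "span (set (map (scale w) es)) = W"
    unfolding W[symmetric] by (auto simp: span_eq)
  fix u i
  assume u: "(\<Sum>j<length (map (scale w) es). scale (u j) (map (scale w) es ! j)) = 0"
    and i: "i < length (map (scale w) es)"
  from u have "(\<Sum>j<length es. scale (u j * w) (es ! j)) = 0" by simp
  from ordered_basis_coeff_eq_0[OF es this] i have "u i * w = 0" by simp
  then show "u i = 0" using w by auto
qed

lemma direct_sum_family_zeroD:
  assumes ds: "direct_sum_family I W" and W: "\<And>i. i \<in> I \<Longrightarrow> 0 \<in> W i"
    and w: "\<And>i. i \<in> I \<Longrightarrow> w i \<in> W i" "(\<Sum>i\<in>I. w i) = 0" and i: "i \<in> I"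
  shows "w i = 0"
proof -
  let ?P = "\<lambda>w. (\<forall>i\<in>I. w i \<in> W i) \<and> (\<forall>i. i \<notin> I \<longrightarrow> w i = 0) \<and> 0 = (\<Sum>i\<in>I. w i)"
  have ex1: "\<exists>!w. ?P w" using ds[unfolded direct_sum_family_def] by (rule spec)
  then obtain w0 where w0: "\<And>w. ?P w \<Longrightarrow> w = w0" by (rule ex1E) blast
  have "(\<lambda>i. if i \<in> I then w i else 0) = w0" by (rule w0) (use w in auto)
  moreover have "(\<lambda>i. 0) = w0" by (rule w0) (use W in auto)
  ultimately have "(\<lambda>i. if i \<in> I then w i else 0) = (\<lambda>i. 0)" by simp
  from fun_cong[OF this, of i] i show ?thesis by simp
qed

text \<open>
  Uniqueness of the components of \<open>0\<close> makes the bases of the summands disjoint, and splits a linear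
  relation between all their vectors into one relation in each summand.
\<close>

lemma ordered_basis_concat:
  assumes ds: "direct_sum_family (set xs) W" and dist: "distinct xs"
    and es: "\<And>i. i \<in> set xs \<Longrightarrow> ordered_basis scale (W i) (es i)"
  shows "ordered_basis scale UNIV (concat (map es xs))"
proof -
  have W: "W i = span (set (es i))" and ind: "independent (set (es i))" and d: "distinct (es i)"
    if "i \<in> set xs" for i using es[OF that] by (simp_all add: ordered_basis_def)
  have W0: "0 \<in> W i" if "i \<in> set xs" for i using W[OF that] span_zero by simp
  note zeroD = direct_sum_family_zeroD[OF ds W0]
  have disj: "set (es i) \<inter> set (es j) = {}" if ij: "i \<in> set xs" "j \<in> set xs" "i \<noteq> j" for i j
  proof (rule ccontr)
    assume "set (es i) \<inter> set (es j) \<noteq> {}"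
    then obtain b where b: "b \<in> set (es i)" "b \<in> set (es j)" by blast
    let ?w = "\<lambda>k. if k = i then b else if k = j then - b else 0"
    have "(\<Sum>k\<in>set xs. ?w k) = (\<Sum>k\<in>{i, j}. ?w k)"
      by (rule sum.mono_neutral_right) (use ij in auto)
    then have "(\<Sum>k\<in>set xs. ?w k) = 0" using ij by simp
    moreover have "?w k \<in> W k" if "k \<in> set xs" for k
      using that b W by (auto intro: span_base span_neg span_zero)
    ultimately have "?w i = 0" using zeroD[of ?w i] ij(1) by blast
    then have "b = 0" by simp
    then show False using ind[OF ij(1)] b(1) dependent_zero by blast
  qed
  have distinct: "distinct (concat (map es xs))"
    using dist d disj
  proof (induction xs)
    case (Cons i xs)
    have "set (es i) \<inter> (\<Union>j\<in>set xs. set (es j)) = {}"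
      using Cons.prems(1) Cons.prems(3)[of i] by (simp add: disjoint_iff) metis
    moreover have "distinct (concat (map es xs))"
      by (rule Cons.IH) (use Cons.prems in simp_all)
    ultimately show ?case using Cons.prems(2)[of i] by simp
  qed simp
  let ?B = "\<Union>i\<in>set xs. set (es i)"
  have sumB: "(\<Sum>b\<in>?B. f b) = (\<Sum>i\<in>set xs. \<Sum>b\<in>set (es i). f b)" for f :: "'e \<Rightarrow> 'e"
    by (rule sum.UNION_disjoint) (use disj in auto)
  have "independent ?B"
  proof
    assume "dependent ?B"
    then obtain u b where u: "(\<Sum>b\<in>?B. scale (u b) b) = 0" "b \<in> ?B" "u b \<noteq> 0"
      using dependent_finite[of ?B] by auto
    obtain i where i: "i \<in> set xs" "b \<in> set (es i)" using u(2) by blast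
    have "(\<Sum>b\<in>set (es i). scale (u b) b) = 0"
    proof (rule zeroD[OF _ _ _ i(1)])
      show "(\<Sum>b\<in>set (es j). scale (u b) b) \<in> W j" if "j \<in> set xs" for j
        using W[OF that] by (auto intro: span_sum span_scale span_base)
    qed (use u(1) sumB in auto)
    from independentD[OF ind[OF i(1)] finite_set subset_refl this i(2)] u(3) show False by simp
  qed
  moreover have "span ?B = UNIV"
  proof -
    have "v \<in> span ?B" for v
    proof -
      obtain w where w: "\<forall>i\<in>set xs. w i \<in> W i" "v = (\<Sum>i\<in>set xs. w i)"
        using ds[unfolded direct_sum_family_def, THEN spec, of v] by (elim ex1E conjE) blast
      have "w i \<in> span ?B" if "i \<in> set xs" for i
        using span_mono[of "set (es i)" ?B] w(1) W[OF that] that by blast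
      then show ?thesis unfolding w(2) by (rule span_sum)
    qed
    then show ?thesis by blast
  qed
  ultimately show ?thesis using distinct by (simp add: ordered_basis_def)
qed

lemma direct_sum_family_span:
  assumes fin: "finite I" "\<And>i. i \<in> I \<Longrightarrow> finite (B i)"
    and disj: "\<And>i j. i \<in> I \<Longrightarrow> j \<in> I \<Longrightarrow> i \<noteq> j \<Longrightarrow> B i \<inter> B j = {}"
    and ind: "independent (\<Union>i\<in>I. B i)" and span: "span (\<Union>i\<in>I. B i) = UNIV"
  shows "direct_sum_family I (\<lambda>i. span (B i))"
  unfolding direct_sum_family_def
proof (intro allI ex_ex1I)
  have sumB: "(\<Sum>b\<in>(\<Union>i\<in>I. B i). f b) = (\<Sum>i\<in>I. \<Sum>b\<in>B i. f b)" for f :: "'e \<Rightarrow> 'e"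
    by (rule sum.UNION_disjoint) (use fin disj in auto)
  have finB: "finite (\<Union>i\<in>I. B i)" using fin by blast
  {
    fix v
    have "v \<in> span (\<Union>i\<in>I. B i)" using span by simp
    then obtain u where u: "v = (\<Sum>b\<in>(\<Union>i\<in>I. B i). scale (u b) b)"
      by (auto simp: span_finite[OF finB])
    let ?w = "\<lambda>i. if i \<in> I then \<Sum>b\<in>B i. scale (u b) b else 0"
    have "(\<forall>i\<in>I. ?w i \<in> span (B i)) \<and> (\<forall>i. i \<notin> I \<longrightarrow> ?w i = 0) \<and> v = (\<Sum>i\<in>I. ?w i)"
    proof (intro conjI ballI allI impI)
      show "?w i \<in> span (B i)" if "i \<in> I" for i
        using that by (auto intro: span_sum span_scale span_base)
    qed (use u sumB in auto)
    then show "\<exists>w. (\<forall>i\<in>I. w i \<in> span (B i)) \<and> (\<forall>i. i \<notin> I \<longrightarrow> w i = 0) \<and> v = (\<Sum>i\<in>I. w i)"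
      by (rule exI[of _ ?w])
  }
  fix v w w'
  assume w: "(\<forall>i\<in>I. w i \<in> span (B i)) \<and> (\<forall>i. i \<notin> I \<longrightarrow> w i = 0) \<and> v = (\<Sum>i\<in>I. w i)"
    and w': "(\<forall>i\<in>I. w' i \<in> span (B i)) \<and> (\<forall>i. i \<notin> I \<longrightarrow> w' i = 0) \<and> v = (\<Sum>i\<in>I. w' i)"
  have "\<forall>i\<in>I. \<exists>u. w i - w' i = (\<Sum>b\<in>B i. scale (u b) b)"
  proof
    fix i assume i: "i \<in> I"
    then have "w i - w' i \<in> span (B i)" using w w' by (simp add: span_diff)
    then show "\<exists>u. w i - w' i = (\<Sum>b\<in>B i. scale (u b) b)"
      using span_finite[OF fin(2)[OF i]] by auto
  qed
  then obtain u where u: "\<And>i. i \<in> I \<Longrightarrow> w i - w' i = (\<Sum>b\<in>B i. scale (u i b) b)"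
    by metis
  define U where "U b = u (THE i. i \<in> I \<and> b \<in> B i) b" for b
  have U: "U b = u i b" if "i \<in> I" "b \<in> B i" for i b
  proof -
    have "(THE i. i \<in> I \<and> b \<in> B i) = i" using that disj by (intro the_equality) blast+
    then show ?thesis by (simp add: U_def)
  qed
  have "(\<Sum>b\<in>(\<Union>i\<in>I. B i). scale (U b) b) = (\<Sum>i\<in>I. w i - w' i)"
    unfolding sumB by (rule sum.cong) (simp_all add: u U)
  also have "\<dots> = 0" using w w' by (simp add: sum_subtractf)
  finally have U0: "U b = 0" if "b \<in> (\<Union>i\<in>I. B i)" for b
    using independentD[OF ind finB subset_refl _ that] by blast
  show "w = w'"
  proof
    fix i show "w i = w' i"
    proof (cases "i \<in> I")
      case True
      then have "w i - w' i = (\<Sum>b\<in>B i. scale (U b) b)" by (simp add: u U)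
      also have "\<dots> = 0"
        by (intro sum.neutral ballI) (use U0 True in \<open>metis UN_I scale_zero_left\<close>)
      finally show ?thesis by simp
    qed (use w w' in simp)
  qed
qed

end

section \<open>Vectors killed by a power of \<open>D - f\<close>\<close>

text \<open>
  Concatenated Jordan blocks, recorded by their diagonal entries alone: each basis vector either
  ends its block or is linked to the next vector, which then has the same diagonal
  entry. Stated for individual vectors, this form is stable under concatenation.
\<close>

definition jordan_chain ::
  "('r::comm_ring_1 fls \<Rightarrow> 'e::ab_group_add \<Rightarrow> 'e) \<Rightarrow> ('e \<Rightarrow> 'e) \<Rightarrow> 'e list \<Rightarrow> 'r fls list \<Rightarrow> bool" where
  "jordan_chain scale D es ds \<longleftrightarrow> length ds = length es \<and>
     (\<forall>j<length es. D (es ! j) = scale (ds ! j) (es ! j) \<or>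
        Suc j < length es \<and> ds ! Suc j = ds ! j \<and> D (es ! j) = scale (ds ! j) (es ! j) + es ! Suc j)"

lemma jordan_chain_Nil [simp]: "jordan_chain scale D [] []"
  by (simp add: jordan_chain_def)

lemma jordan_chain_append:
  assumes 1: "jordan_chain scale D es ds" and 2: "jordan_chain scale D es' ds'"
  shows "jordan_chain scale D (es @ es') (ds @ ds')"
  unfolding jordan_chain_def
proof (intro conjI allI impI)
  have l: "length ds = length es" "length ds' = length es'"
    using 1 2 by (simp_all add: jordan_chain_def)
  then show "length (ds @ ds') = length (es @ es')" by simp
  fix j assume j: "j < length (es @ es')"
  let ?C = "\<lambda>es ds j. D (es ! j) = scale (ds ! j) (es ! j) \<or>
    Suc j < length es \<and> ds ! Suc j = ds ! j \<and> D (es ! j) = scale (ds ! j) (es ! j) + es ! Suc j"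
  show "?C (es @ es') (ds @ ds') j"
  proof (cases "j < length es")
    case True
    then have "?C es ds j" using 1 by (simp add: jordan_chain_def)
    then show ?thesis using True l by (auto simp: nth_append)
  next
    case False
    then have "?C es' ds' (j - length es)" using 2 j by (simp add: jordan_chain_def)
    then show ?thesis using False l j by (auto simp: nth_append Suc_diff_le)
  qed
qed

lemma jordan_chain_concat:
  assumes "\<And>i. i \<in> set xs \<Longrightarrow> jordan_chain scale D (es i) (ds i)"
  shows "jordan_chain scale D (concat (map es xs)) (concat (map ds xs))"
  using assms by (induction xs) (auto intro: jordan_chain_append)

locale theta_connection = laurent_module scale
  for scale :: "'r::idom fls \<Rightarrow> 'e::ab_group_add \<Rightarrow> 'e" +
  fixes D :: "'e \<Rightarrow> 'e"
  assumes D_add: "D (v + w) = D v + D w"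
    and D_scale: "D (scale f v) = scale (theta_fls f) v + scale f (D v)"
begin

lemma D_0 [simp]: "D 0 = 0"
  using D_add[of 0 0] by simp

lemma D_sum: "D (\<Sum>i\<in>I. v i) = (\<Sum>i\<in>I. D (v i))"
  by (induction I rule: infinite_finite_induct) (simp_all add: D_add)

abbreviation shifted :: "'r fls \<Rightarrow> 'e \<Rightarrow> 'e" where
  "shifted f \<equiv> (\<lambda>v. D v - scale f v)"

text \<open>
  Multiplication by \<open>w\<close> with \<open>\<vartheta> w = (g - f) w\<close> intertwines \<open>D - f\<close> with \<open>D - g\<close>. This is how a
  representative of a character is replaced by another.
\<close>

lemma shifted_scale_eigenvector:
  assumes "theta_fls w = (g - f) * w"
  shows "(shifted g ^^ q) (scale w v) = scale w ((shifted f ^^ q) v)"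
proof (induction q)
  case (Suc q)
  have "shifted g (scale w v) = scale w (shifted f v)" for v
    by (simp add: D_scale assms algebra_simps)
  then show ?case using Suc by simp
qed simp

lemma shifted_power_0: "(shifted f ^^ q) 0 = 0"
  by (induction q) simp_all

lemma ker_power_mono:
  assumes "v \<in> ker_power scale D f q" "q \<le> q'" shows "v \<in> ker_power scale D f q'"
proof -
  have "(shifted f ^^ q') v = (shifted f ^^ (q' - q)) ((shifted f ^^ q) v)"
    using assms(2) by (simp add: funpow_add[symmetric, THEN fun_cong, simplified])
  then show ?thesis using assms(1) shifted_power_0 by (simp add: ker_power_def)
qed

lemma subconnection_hull_ker_power_gauge:
  assumes Q: "\<And>n. n > 0 \<Longrightarrow> (of_nat n :: 'r) dvd 1" and fg: "gauge_equiv f g"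
  shows "subconnection scale D hull ker_power scale D f q
       = subconnection scale D hull ker_power scale D g q"
proof -
  have *: "W \<supseteq> ker_power scale D f q"
    if fg: "gauge_equiv f g" and W: "subconnection scale D W" "W \<supseteq> ker_power scale D g q"
    for f g :: "'r fls" and W
  proof
    fix v assume v: "v \<in> ker_power scale D f q"
    have "gauge_equiv (g - f) 0" using fg by (simp add: gauge_equiv_0_diff gauge_equiv_sym)
    from theta_eigenvector_unit[OF Q this] obtain w w' where
      w: "w * w' = 1" "theta_fls w = (g - f) * w" by metis
    have "scale w v \<in> ker_power scale D g q"
      using v shifted_scale_eigenvector[OF w(2), of q v] by (simp add: ker_power_def)
    then have "scale w' (scale w v) \<in> W"
      using W unfolding subconnection_def by (meson subsetD subspace_scale)
    then show "v \<in> W" using w(1) by (simp add: mult.commute)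
  qed
  show ?thesis unfolding hull_def
    using *[OF fg] *[OF gauge_equiv_sym[OF fg]] by (intro arg_cong[where f = Inter]) blast
qed

text \<open>
  Along a block, \<open>D - d\<^sub>j\<close> replaces a vector by the next one, and the last one by \<open>0\<close>.
\<close>

lemma jordan_chain_kernel:
  assumes "jordan_chain scale D es ds" "j < length es"
  shows "es ! j \<in> ker_power scale D (ds ! j) (length es)"
proof -
  have "(shifted (ds ! j) ^^ (length es - j)) (es ! j) = 0"
    using assms(2)
  proof (induction "length es - j" arbitrary: j)
    case (Suc k)
    have j: "length es - j = Suc (length es - Suc j)" using Suc.prems by simp
    from assms(1) Suc.prems consider "shifted (ds ! j) (es ! j) = 0" |
      "Suc j < length es" "ds ! Suc j = ds ! j" "shifted (ds ! j) (es ! j) = es ! Suc j"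
      by (auto simp: jordan_chain_def)
    then show ?case
    proof cases
      case 1
      then show ?thesis unfolding j funpow_Suc_right o_def by (simp add: shifted_power_0)
    next
      case 2
      then show ?thesis unfolding j funpow_Suc_right o_def
        using Suc.hyps(1)[of "Suc j"] Suc.hyps(2) by simp
    qed
  qed simp
  then have "es ! j \<in> ker_power scale D (ds ! j) (length es - j)" by (simp add: ker_power_def)
  then show ?thesis by (rule ker_power_mono) simp
qed

lemma shifted_coeffs:
  assumes "jordan_chain scale D es ds"
  defines "link \<equiv> \<lambda>j. D (es ! j) \<noteq> scale (ds ! j) (es ! j)"
  shows "shifted f (\<Sum>i<length es. scale (u i) (es ! i)) =
    (\<Sum>i<length es. scale (theta_fls (u i) + (ds ! i - f) * u i +
        (if i > 0 \<and> link (i - 1) then u (i - 1) else 0)) (es ! i))"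
proof -
  have D_es: "D (es ! i) = scale (ds ! i) (es ! i) + (if link i then es ! Suc i else 0)"
    and link: "link i \<Longrightarrow> Suc i < length es" if "i < length es" for i
    using that assms by (auto simp: jordan_chain_def)
  have tail: "(\<Sum>i<length es. scale (u i) (if link i then es ! Suc i else 0)) =
     (\<Sum>i<length es. scale (if i > 0 \<and> link (i - 1) then u (i - 1) else 0) (es ! i))"
  proof (cases "length es")
    case (Suc m)
    then have "\<not> link m" using link[of m] by auto
    then show ?thesis unfolding Suc
      by (subst sum.lessThan_Suc, subst sum.lessThan_Suc_shift) (auto intro!: sum.cong)
  qed simp
  have "shifted f (\<Sum>i<length es. scale (u i) (es ! i)) =
     (\<Sum>i<length es. scale (theta_fls (u i)) (es ! i) +
       scale (u i) (scale (ds ! i) (es ! i) + (if link i then es ! Suc i else 0))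
       - scale f (scale (u i) (es ! i)))"
    by (simp add: D_sum D_scale D_es scale_sum_right sum_subtractf)
  also have "\<dots> = (\<Sum>i<length es. scale (theta_fls (u i) + (ds ! i - f) * u i) (es ! i)) +
      (\<Sum>i<length es. scale (u i) (if link i then es ! Suc i else 0))"
    unfolding sum.distrib[symmetric] by (rule sum.cong) (auto simp: algebra_simps)
  also have "\<dots> = (\<Sum>i<length es. scale (theta_fls (u i) + (ds ! i - f) * u i +
        (if i > 0 \<and> link (i - 1) then u (i - 1) else 0)) (es ! i))"
    unfolding tail sum.distrib[symmetric] by (rule sum.cong) (simp_all add: scale_left_distrib)
  finally show ?thesis .
qed

text \<open>
  Double induction. The outer one, on \<open>q\<close>, applies to the coordinates \<open>w\<close> of \<open>(D - f) v\<close>, so \<open>w\<^sub>i\<close>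
  vanishes. The inner one, on \<open>i\<close>, removes the contribution of the preceding vector of the block,
  which has the same diagonal entry; what remains is \<open>\<vartheta> u\<^sub>i = (f - d\<^sub>i) u\<^sub>i\<close>, which has no nonzero
  solution.
\<close>

lemma kernel_coeff_eq_0:
  assumes es: "ordered_basis scale W es" and chain: "jordan_chain scale D es ds"
    and ker: "(shifted f ^^ q) (\<Sum>i<length es. scale (u i) (es ! i)) = 0"
    and i: "i < length es" "\<not> gauge_equiv (ds ! i) f"
  shows "u i = 0"
  using ker i
proof (induction q arbitrary: u i)
  case 0
  then show ?case using ordered_basis_coeff_eq_0[OF es] by simp
next
  case (Suc q)
  define link where "link = (\<lambda>j. D (es ! j) \<noteq> scale (ds ! j) (es ! j))"
  define w where "w i = theta_fls (u i) + (ds ! i - f) * u i +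
        (if i > 0 \<and> link (i - 1) then u (i - 1) else 0)" for i
  have "(shifted f ^^ q) (\<Sum>i<length es. scale (w i) (es ! i)) = 0"
    using Suc.prems(1) shifted_coeffs[OF chain, where f = f and u = u]
    by (simp add: funpow_Suc_right w_def link_def del: funpow.simps)
  note w0 = Suc.IH[OF this]
  have step: "u i = 0" if "i < length es" "\<not> gauge_equiv (ds ! i) f" for i
    using that
  proof (induction i)
    case 0
    then have eq: "theta_fls (u 0) = (f - ds ! 0) * u 0"
      using w0[of 0] by (simp add: w_def algebra_simps)
    show ?case
      using gauge_equiv_if_theta_eigenvector[OF eq] 0 gauge_equiv_0_diff gauge_equiv_sym by blast
  next
    case (Suc i)
    have "(if link i then u i else 0) = 0"
    proof (cases "link i")
      case True
      then have "ds ! Suc i = ds ! i" 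
        using chain Suc.prems(1) Suc_lessD unfolding jordan_chain_def link_def by blast
      then show ?thesis using Suc by simp
    qed simp
    then have eq: "theta_fls (u (Suc i)) = (f - ds ! Suc i) * u (Suc i)"
      using w0[OF Suc.prems] by (simp add: w_def algebra_simps split: if_splits)
    show ?case
      using gauge_equiv_if_theta_eigenvector[OF eq] Suc.prems gauge_equiv_0_diff gauge_equiv_sym by blast
  qed
  then show ?case using Suc.prems by blast
qed

lemma ker_power_subset_span:
  assumes es: "ordered_basis scale UNIV es" and chain: "jordan_chain scale D es ds"
  shows "ker_power scale D f q \<subseteq> span {es ! i | i. i < length es \<and> gauge_equiv (ds ! i) f}"
proof
  fix v assume v: "v \<in> ker_power scale D f q"
  have "v \<in> span (set es)" using es by (simp add: ordered_basis_def)
  then obtain u where u: "v = (\<Sum>i<length es. scale (u i) (es ! i))" by (rule list_coeffs_in_span)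
  have "scale (u i) (es ! i) \<in> span {es ! i | i. i < length es \<and> gauge_equiv (ds ! i) f}"
    if "i < length es" for i
  proof (cases "gauge_equiv (ds ! i) f")
    case True
    then show ?thesis using that by (intro span_scale span_base) blast
  next
    case False
    have "u i = 0"
      by (rule kernel_coeff_eq_0[OF es chain _ that False, of q]) (use v u in \<open>simp add: ker_power_def\<close>)
    then show ?thesis by (simp add: span_zero)
  qed
  then show "v \<in> span {es ! i | i. i < length es \<and> gauge_equiv (ds ! i) f}"
    unfolding u by (auto intro: span_sum)
qed

end

section \<open>Jordan blocks and block diagonal matrices\<close>

text \<open>
  The shape shared by a single block and by a block diagonal matrix of such blocks: a
  subdiagonal entry \<open>1\<close> only occurs between equal diagonal entries.
\<close>

definition jordan_shaped :: "'a::zero_neq_one set \<Rightarrow> 'a mat \<Rightarrow> bool" where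
  "jordan_shaped S T \<longleftrightarrow> dim_col T = dim_row T \<and>
     (\<forall>j<dim_row T. T $$ (j, j) \<in> S \<and> (\<forall>i<dim_row T. i \<noteq> j \<longrightarrow>
        T $$ (i, j) = 0 \<or> i = Suc j \<and> T $$ (i, j) = 1 \<and> T $$ (i, i) = T $$ (j, j)))"

lemma jordan_shaped_if_is_Jflat: "is_Jflat r f A \<Longrightarrow> f \<in> S \<Longrightarrow> jordan_shaped S A"
  by (auto simp: is_Jflat_def jordan_shaped_def split: if_splits)

lemma is_Jflat_diag: "is_Jflat r f A \<Longrightarrow> j < r \<Longrightarrow> A $$ (j, j) = f"
  unfolding is_Jflat_def by metis

lemma is_Jflat_if_jordan_shaped: "jordan_shaped {f} A \<Longrightarrow> is_Jflat (dim_row A) f A"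
  unfolding is_Jflat_def jordan_shaped_def
  by (metis carrier_matI insertCI singletonD)

lemma jordan_shaped_diag_block_mat:
  assumes "\<And>B. B \<in> set Bs \<Longrightarrow> jordan_shaped S B"
  shows "jordan_shaped S (diag_block_mat Bs)"
  using assms
proof (induction Bs)
  case Nil
  then show ?case by (simp add: jordan_shaped_def)
next
  case (Cons B Bs)
  let ?T = "diag_block_mat Bs"
  have B: "jordan_shaped S B" and T: "jordan_shaped S ?T" using Cons by simp_all
  have dim: "dim_col B = dim_row B" "dim_col ?T = dim_row ?T" 
    using B T by (simp_all add: jordan_shaped_def)
  show ?case
    unfolding jordan_shaped_def diag_block_mat.simps Let_def
  proof (intro conjI allI impI)
    let ?F = "four_block_mat B (0\<^sub>m (dim_row B) (dim_col ?T)) (0\<^sub>m (dim_row ?T) (dim_col B)) ?T"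
    show "dim_col ?F = dim_row ?F" using dim by simp
    fix j assume j: "j < dim_row ?F"
    show "?F $$ (j, j) \<in> S"
      using j dim B T by (cases "j < dim_row B") (simp_all add: jordan_shaped_def)
    fix i assume i: "i < dim_row ?F" "i \<noteq> j"
    consider "i < dim_row B" "j < dim_row B" | "i < dim_row B" "\<not> j < dim_row B"
      | "\<not> i < dim_row B" "j < dim_row B" | "\<not> i < dim_row B" "\<not> j < dim_row B" by blast
    then show "?F $$ (i, j) = 0 \<or> i = Suc j \<and> ?F $$ (i, j) = 1 \<and> ?F $$ (i, i) = ?F $$ (j, j)"
    proof cases
      case 1
      then have "B $$ (i, j) = 0 \<or> i = Suc j \<and> B $$ (i, j) = 1 \<and> B $$ (i, i) = B $$ (j, j)"
        using B i by (simp add: jordan_shaped_def)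
      then show ?thesis using 1 i j dim by simp
    next
      case 4
      define i' j' where ij': "i' = i - dim_row B" "j' = j - dim_row B"
      have "i' < dim_row ?T" "j' < dim_row ?T" "i' \<noteq> j'" using 4 i j ij' by auto
      then have "?T $$ (i', j') = 0 \<or> i' = Suc j' \<and> ?T $$ (i', j') = 1 \<and> ?T $$ (i', i') = ?T $$ (j', j')"
        using T by (simp add: jordan_shaped_def)
      then show ?thesis using 4 i j dim ij' by auto
    qed (use i j dim in simp_all)
  qed
qed

lemma has_Mat_dim:
  assumes "has_Mat scale D es A" shows "dim_row A = length es" "dim_col A = length es"
  using assms unfolding has_Mat_def by (blast dest: carrier_matD)+

definition same_off_diagonal :: "'a mat \<Rightarrow> 'a mat \<Rightarrow> bool" where
  "same_off_diagonal A B \<longleftrightarrow> dim_col A = dim_row A \<and> dim_row B = dim_row A \<and> dim_col B = dim_row A \<and>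
     (\<forall>i<dim_row A. \<forall>j<dim_row A. i \<noteq> j \<longrightarrow> A $$ (i, j) = B $$ (i, j))"

lemma same_off_diagonal_diag_block_mat:
  assumes "\<And>x. x \<in> set xs \<Longrightarrow> same_off_diagonal (A x) (B x)"
  shows "same_off_diagonal (diag_block_mat (map A xs)) (diag_block_mat (map B xs))"
  using assms
proof (induction xs)
  case Nil
  then show ?case by (simp add: same_off_diagonal_def)
next
  case (Cons x xs)
  have "same_off_diagonal (A x) (B x)"
    "same_off_diagonal (diag_block_mat (map A xs)) (diag_block_mat (map B xs))"
    (is "same_off_diagonal ?A ?B") using Cons by simp_all
  then have 1: "dim_col (A x) = dim_row (A x)" "dim_row (B x) = dim_row (A x)"
      "dim_col (B x) = dim_row (A x)"
      "\<And>i j. i < dim_row (A x) \<Longrightarrow> j < dim_row (A x) \<Longrightarrow> i \<noteq> j \<Longrightarrow> A x $$ (i, j) = B x $$ (i, j)"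
    and 2: "dim_col ?A = dim_row ?A" "dim_row ?B = dim_row ?A" "dim_col ?B = dim_row ?A"
      "\<And>i j. i < dim_row ?A \<Longrightarrow> j < dim_row ?A \<Longrightarrow> i \<noteq> j \<Longrightarrow> ?A $$ (i, j) = ?B $$ (i, j)"
    by (simp_all add: same_off_diagonal_def)
  show ?case
    unfolding same_off_diagonal_def list.map diag_block_mat.simps Let_def
  proof (intro conjI allI impI)
    fix i j
    let ?F = "\<lambda>A T. four_block_mat A (0\<^sub>m (dim_row A) (dim_col T)) (0\<^sub>m (dim_row T) (dim_col A)) T"
    assume ij: "i < dim_row (?F (A x) ?A)" "j < dim_row (?F (A x) ?A)" "i \<noteq> j"
    then have "i - dim_row (A x) \<noteq> j - dim_row (A x)" if "\<not> i < dim_row (A x)" "\<not> j < dim_row (A x)"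
      using that by linarith
    then show "?F (A x) ?A $$ (i, j) = ?F (B x) ?B $$ (i, j)"
      using ij by (simp add: 1(1-3) 2(1-3)) (use ij 1(4) 2(4) in auto)
  qed (simp_all add: 1(1-3) 2(1-3))
qed

lemma sum_lessThan_add:
  fixes f :: "nat \<Rightarrow> 'a::comm_monoid_add"
  shows "(\<Sum>i<m + n. f i) = (\<Sum>i<m. f i) + (\<Sum>i<n. f (m + i))"
  by (induction n) (simp_all add: algebra_simps)

context laurent_module
begin

lemma has_Mat_append:
  assumes A: "has_Mat scale D es A" and B: "has_Mat scale D es' B"
  shows "has_Mat scale D (es @ es')
    (four_block_mat A (0\<^sub>m (dim_row A) (dim_col B)) (0\<^sub>m (dim_row B) (dim_col A)) B)"
    (is "has_Mat scale D _ ?F")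
  unfolding has_Mat_def
proof (intro conjI allI impI)
  have dim [simp]: "dim_row A = length es" "dim_col A = length es"
    "dim_row B = length es'" "dim_col B = length es'"
    by (rule has_Mat_dim[OF A] has_Mat_dim[OF B])+
  show "?F \<in> carrier_mat (length (es @ es')) (length (es @ es'))" by (rule carrier_matI) simp_all
  fix j assume j: "j < length (es @ es')"
  show "D ((es @ es') ! j) = (\<Sum>i<length (es @ es'). scale (?F $$ (i, j)) ((es @ es') ! i))"
  proof (cases "j < length es")
    case True
    then have "D (es ! j) = (\<Sum>i<length es. scale (A $$ (i, j)) (es ! i))"
      using A by (simp add: has_Mat_def)
    then show ?thesis using True j by (simp add: sum_lessThan_add nth_append)
  next
    case False
    then have "D (es' ! (j - length es)) = (\<Sum>i<length es'. scale (B $$ (i, j - length es)) (es' ! i))"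
      using B j by (simp add: has_Mat_def)
    then show ?thesis using False j by (simp add: sum_lessThan_add nth_append)
  qed
qed

lemma has_Mat_concat:
  assumes "\<And>x. x \<in> set xs \<Longrightarrow> has_Mat scale D (es x) (A x)"
  shows "has_Mat scale D (concat (map es xs)) (diag_block_mat (map A xs))"
  using assms
proof (induction xs)
  case Nil
  then show ?case by (simp add: has_Mat_def)
next
  case (Cons x xs)
  then show ?case using has_Mat_append[of D "es x" "A x"] by (simp add: Let_def)
qed

lemma has_Mat_jordan_shaped:
  assumes "has_Mat scale D es T" "jordan_shaped S T"
  shows "jordan_chain scale D es (map (\<lambda>j. T $$ (j, j)) [0..<length es])"
  unfolding jordan_chain_def
proof (intro conjI allI impI)
  let ?n = "length es"
  have dim [simp]: "dim_row T = ?n" "dim_col T = ?n" by (rule has_Mat_dim[OF assms(1)])+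
  have T: "T $$ (i, j) = 0 \<or> i = Suc j \<and> T $$ (i, j) = 1 \<and> T $$ (i, i) = T $$ (j, j)"
    if "j < ?n" "i < ?n" "i \<noteq> j" for i j using that assms(2) by (simp add: jordan_shaped_def)
  fix j assume j: "j < ?n"
  have Dj: "D (es ! j) = (\<Sum>i<?n. scale (T $$ (i, j)) (es ! i))"
    using assms(1) j by (simp add: has_Mat_def)
  also have "\<dots> = scale (T $$ (j, j)) (es ! j) + (\<Sum>i\<in>{..<?n} - {j}. scale (T $$ (i, j)) (es ! i))"
    by (rule sum.remove) (use j in auto)
  finally have D: "D (es ! j) =
    scale (T $$ (j, j)) (es ! j) + (\<Sum>i\<in>{..<?n} - {j}. scale (T $$ (i, j)) (es ! i))" .
  show "D (es ! j) = scale (map (\<lambda>j. T $$ (j, j)) [0..<?n] ! j) (es ! j) \<or>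
    Suc j < ?n \<and> map (\<lambda>j. T $$ (j, j)) [0..<?n] ! Suc j = map (\<lambda>j. T $$ (j, j)) [0..<?n] ! j \<and>
    D (es ! j) = scale (map (\<lambda>j. T $$ (j, j)) [0..<?n] ! j) (es ! j) + es ! Suc j"
  proof (cases "Suc j < ?n \<and> T $$ (Suc j, j) = 1 \<and> T $$ (Suc j, Suc j) = T $$ (j, j)")
    case True
    have "(\<Sum>i\<in>{..<?n} - {j}. scale (T $$ (i, j)) (es ! i)) = (\<Sum>i\<in>{Suc j}. scale (T $$ (i, j)) (es ! i))"
      by (rule sum.mono_neutral_right) (use True T[OF j] in \<open>force+\<close>)
    then show ?thesis using True D by simp
  next
    case False
    have "(\<Sum>i\<in>{..<?n} - {j}. scale (T $$ (i, j)) (es ! i)) = 0"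
      by (rule sum.neutral) (use False T[OF j] in force)
    then show ?thesis using D j by simp
  qed
qed simp

lemma has_Mat_Jflat_chain:
  assumes "has_Mat scale D es A" "is_Jflat (length es) f A"
  shows "jordan_chain scale D es (replicate (length es) f)"
proof -
  have "map (\<lambda>j. A $$ (j, j)) [0..<length es] = replicate (length es) f"
    by (rule nth_equalityI) (simp_all add: is_Jflat_diag[OF assms(2)])
  then show ?thesis
    using has_Mat_jordan_shaped[OF assms(1) jordan_shaped_if_is_Jflat[OF assms(2) UNIV_I]] by simp
qed

text \<open>
  Covers both changes made to a Jordan matrix: with \<open>D' = D\<close> the passage to the basis \<open>w e\<^sub>j\<close>, where
  \<open>\<vartheta> w = h w\<close>, and with \<open>w = 1\<close> the passage from \<open>D\<close> to \<open>D + h\<close>.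
\<close>

lemma has_Mat_add_scalar:
  assumes A: "has_Mat scale D es A"
    and D': "\<And>j. j < length es \<Longrightarrow> D' (es' ! j) = scale w (D (es ! j)) + scale h (es' ! j)"
    and es': "es' = map (scale w) es"
  shows "has_Mat scale D' es' (A + h \<cdot>\<^sub>m 1\<^sub>m (length es))"
  unfolding has_Mat_def
proof (intro conjI allI impI)
  have dim [simp]: "dim_row A = length es" "dim_col A = length es"
    by (rule has_Mat_dim[OF A])+
  show "A + h \<cdot>\<^sub>m 1\<^sub>m (length es) \<in> carrier_mat (length es') (length es')"
    by (rule carrier_matI) (simp_all add: es')
  fix j assume "j < length es'"
  then have j: "j < length es" using es' by simp
  have "(\<Sum>i<length es'. scale ((A + h \<cdot>\<^sub>m 1\<^sub>m (length es)) $$ (i, j)) (es' ! i))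
    = (\<Sum>i<length es. scale w (scale (A $$ (i, j)) (es ! i)) + (if i = j then scale h (es' ! j) else 0))"
    unfolding es' by (simp, rule sum.cong) (use j in \<open>auto simp: algebra_simps\<close>)
  also have "\<dots> = scale w (\<Sum>i<length es. scale (A $$ (i, j)) (es ! i)) + scale h (es' ! j)"
    using j by (simp add: sum.distrib scale_sum_right)
  also have "\<dots> = D' (es' ! j)" using D'[OF j] A j by (simp add: has_Mat_def)
  finally show "D' (es' ! j) =
    (\<Sum>i<length es'. scale ((A + h \<cdot>\<^sub>m 1\<^sub>m (length es)) $$ (i, j)) (es' ! i))" ..
qed

lemma is_Jflat_add_scalar:
  fixes h :: "'a::comm_ring_1"
  assumes A: "is_Jflat r f A" shows "is_Jflat r (f + h) (A + h \<cdot>\<^sub>m 1\<^sub>m r)"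
  unfolding is_Jflat_def
proof (intro conjI allI impI)
  have dim: "dim_row A = r" "dim_col A = r" using A by (auto simp: is_Jflat_def)
  then show "A + h \<cdot>\<^sub>m 1\<^sub>m r \<in> carrier_mat r r" by (intro carrier_matI) simp_all
  fix i j assume ij: "i < r" "j < r"
  then have "if i = j then A $$ (i, j) = f else if i = Suc j then A $$ (i, j) \<in> {0, 1}
        else A $$ (i, j) = 0"
    using A unfolding is_Jflat_def by blast
  then show "if i = j then (A + h \<cdot>\<^sub>m 1\<^sub>m r) $$ (i, j) = f + h
      else if i = Suc j then (A + h \<cdot>\<^sub>m 1\<^sub>m r) $$ (i, j) \<in> {0, 1}
      else (A + h \<cdot>\<^sub>m 1\<^sub>m r) $$ (i, j) = 0"
    using ij dim by (simp split: if_splits)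
qed

lemma same_off_diagonal_add_scalar:
  fixes h :: "'a::comm_ring_1"
  assumes "A \<in> carrier_mat r r" shows "same_off_diagonal (A + h \<cdot>\<^sub>m 1\<^sub>m r) A"
  unfolding same_off_diagonal_def using carrier_matD[OF assms] by simp

end

section \<open>Uniqueness of the TLJ-decomposition and of the polar part\<close>

context laurent_module
begin

lemma TLJ_form_hull:
  assumes "TLJ_form scale D \<Phi> E" "\<phi> \<in> \<Phi>"
  shows "\<exists>f q0. represents f \<phi> \<and>
    (\<forall>q\<ge>q0. E \<phi> = subconnection scale D hull ker_power scale D f q)"
  using assms unfolding TLJ_form_def TLJ_decomposition_def by blast

lemma TLJ_form_jordan_chain:
  assumes "TLJ_form scale D \<Phi> E"
  obtains es ds where "ordered_basis scale UNIV es" "jordan_chain scale D es ds"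
    "\<And>d. d \<in> set ds \<Longrightarrow> \<exists>\<phi>\<in>\<Phi>. represents d \<phi>"
proof -
  have fin: "finite \<Phi>" and ds: "direct_sum_family \<Phi> E"
    and form: "\<forall>\<phi>\<in>\<Phi>. \<exists>es f A. ordered_basis scale (E \<phi>) es \<and> represents f \<phi> \<and>
        is_Jflat (length es) f A \<and> has_Mat scale D es A"
    using assms by (auto simp: TLJ_form_def TLJ_decomposition_def)
  from form obtain es f A where *: "\<And>\<phi>. \<phi> \<in> \<Phi> \<Longrightarrow> ordered_basis scale (E \<phi>) (es \<phi>) \<and> represents (f \<phi>) \<phi> \<and>
        is_Jflat (length (es \<phi>)) (f \<phi>) (A \<phi>) \<and> has_Mat scale D (es \<phi>) (A \<phi>)"
    by metis
  obtain \<phi>s where \<phi>s: "set \<phi>s = \<Phi>" "distinct \<phi>s" using finite_distinct_list[OF fin] by blast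
  show thesis
  proof
    show "ordered_basis scale UNIV (concat (map es \<phi>s))"
      by (rule ordered_basis_concat) (use ds \<phi>s * in auto)
    show "jordan_chain scale D (concat (map es \<phi>s))
        (concat (map (\<lambda>\<phi>. replicate (length (es \<phi>)) (f \<phi>)) \<phi>s))"
      by (rule jordan_chain_concat) (use * \<phi>s has_Mat_Jflat_chain in blast)
    show "\<exists>\<phi>\<in>\<Phi>. represents d \<phi>"
      if "d \<in> set (concat (map (\<lambda>\<phi>. replicate (length (es \<phi>)) (f \<phi>)) \<phi>s))" for d
      using that \<phi>s * by auto
  qed
qed

text \<open>
  As the two matrices agree off the diagonal, \<open>P = D - D0\<close> is diagonal in the common basis, with the polar
  parts as entries. The blocks of \<open>D\<close> supply the links: the zeros and ones below
  the diagonal of \<open>D0\<close> alone would not show that linked vectors have the same polar part.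
\<close>

lemma joint_Jflat_form_chain:
  assumes joint: "joint_Jflat_form scale D0 D W es c fs rs" and P: "\<And>v. D v = D0 v + P v"
  obtains ds where "jordan_chain scale D es ds"
    "\<And>i. i < length es \<Longrightarrow> \<exists>g\<in>xinv_Rxinv. ds ! i = fls_const c + g \<and> P (es ! i) = scale g (es ! i)"
proof -
  let ?n = "length es"
  obtain A Bs where len: "length rs = length fs" "length Bs = length fs" and fs: "set fs \<subseteq> xinv_Rxinv"
    and A: "is_Jflat ?n (fls_const c) A" "has_Mat scale D0 es A"
    and Bs: "\<forall>i<length fs. is_Jflat (rs ! i) (fls_const c + fs ! i) (Bs ! i)"
    and T: "has_Mat scale D es (diag_block_mat Bs)"
    and off: "\<forall>i<?n. \<forall>j<?n. i \<noteq> j \<longrightarrow> A $$ (i, j) = diag_block_mat Bs $$ (i, j)"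
    using joint unfolding joint_Jflat_form_def by blast
  let ?T = "diag_block_mat Bs"
  have js: "jordan_shaped ((\<lambda>g. fls_const c + g) ` xinv_Rxinv) ?T"
  proof (rule jordan_shaped_diag_block_mat)
    fix B assume "B \<in> set Bs"
    then obtain i where i: "i < length fs" "B = Bs ! i" using len by (metis in_set_conv_nth)
    then have "fls_const c + fs ! i \<in> (\<lambda>g. fls_const c + g) ` xinv_Rxinv" using fs nth_mem by blast
    then show "jordan_shaped ((\<lambda>g. fls_const c + g) ` xinv_Rxinv) B"
      using Bs i jordan_shaped_if_is_Jflat by blast
  qed
  show thesis
  proof
    show "jordan_chain scale D es (map (\<lambda>j. ?T $$ (j, j)) [0..<?n])"
      by (rule has_Mat_jordan_shaped[OF T js])
    fix i assume i: "i < ?n"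
    have "?T $$ (i, i) \<in> (\<lambda>g. fls_const c + g) ` xinv_Rxinv"
      using js has_Mat_dim[OF T] i by (simp add: jordan_shaped_def)
    then obtain g where g: "g \<in> xinv_Rxinv" "?T $$ (i, i) = fls_const c + g" by blast
    have "P (es ! i) = D (es ! i) - D0 (es ! i)" using P by simp
    also have "\<dots> = (\<Sum>k<?n. scale (?T $$ (k, i)) (es ! k) - scale (A $$ (k, i)) (es ! k))"
      using T A(2) i by (simp add: has_Mat_def sum_subtractf)
    also have "\<dots> = (\<Sum>k<?n. if k = i then scale g (es ! i) else 0)"
      by (rule sum.cong) (use off i A(1) g(2) in \<open>auto simp: is_Jflat_def algebra_simps\<close>)
    also have "\<dots> = scale g (es ! i)" using i by simp
    finally show "\<exists>g\<in>xinv_Rxinv. map (\<lambda>j. ?T $$ (j, j)) [0..<?n] ! i = fls_const c + g \<and>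
        P (es ! i) = scale g (es ! i)"
      using g i by auto
  qed
qed

end

context theta_connection
begin

lemma character_of_chain:
  assumes es: "ordered_basis scale UNIV es" and chain: "jordan_chain scale D es ds"
    and v: "v \<in> ker_power scale D f q" "v \<noteq> 0"
  shows "\<exists>d\<in>set ds. gauge_equiv d f"
proof (rule ccontr)
  assume "\<not> ?thesis"
  then have "{es ! i | i. i < length es \<and> gauge_equiv (ds ! i) f} = {}"
    using chain nth_mem[of _ ds] unfolding jordan_chain_def by fastforce
  moreover have "v \<in> span {es ! i | i. i < length es \<and> gauge_equiv (ds ! i) f}"
    using ker_power_subset_span[OF es chain] v(1) by blast
  ultimately have "v \<in> span {}" by metis
  then show False using v(2) by simp
qed

text \<open>
  A basis vector of the summand for \<open>\<phi>\<close> is nonzero and killed by a power of \<open>D - f\<close>, so it involves a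
  basis vector of the second form whose diagonal entry represents \<open>\<phi>\<close>.
\<close>

lemma TLJ_form_characters_subset:
  assumes \<Phi>: "TLJ_form scale D \<Phi> E" and \<Psi>: "TLJ_form scale D \<Psi> F"
  shows "\<Phi> \<subseteq> \<Psi>"
proof
  fix \<phi> assume \<phi>: "\<phi> \<in> \<Phi>"
  have char: "\<Phi> \<subseteq> characters" "\<Psi> \<subseteq> characters"
    using \<Phi> \<Psi> by (simp_all add: TLJ_form_def TLJ_decomposition_def)
  obtain es f A where es: "ordered_basis scale (E \<phi>) es" "represents f \<phi>"
    "is_Jflat (length es) f A" "has_Mat scale D es A"
    using bspec[OF conjunct2[OF \<Phi>[unfolded TLJ_form_def]] \<phi>] by (elim exE conjE)
  have E0: "E \<phi> \<noteq> {0}" using \<Phi> \<phi> by (simp add: TLJ_form_def TLJ_decomposition_def)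
  have ne: "es \<noteq> []"
    using es(1) E0 span_empty unfolding ordered_basis_def by (metis list.set(1))
  then have "es ! 0 \<noteq> 0"
    using es(1) dependent_zero nth_mem[of 0 es] unfolding ordered_basis_def by (metis length_greater_0_conv)
  moreover have "es ! 0 \<in> ker_power scale D f (length es)"
    using jordan_chain_kernel[OF has_Mat_Jflat_chain[OF es(4,3)], of 0] ne by simp
  moreover obtain bs ds where bs: "ordered_basis scale UNIV bs" "jordan_chain scale D bs ds"
    "\<And>d. d \<in> set ds \<Longrightarrow> \<exists>\<psi>\<in>\<Psi>. represents d \<psi>" using TLJ_form_jordan_chain[OF \<Psi>] by metis
  ultimately obtain d where d: "d \<in> set ds" "gauge_equiv d f"
    using character_of_chain[OF bs(1,2)] by blast
  then obtain \<psi> where \<psi>: "\<psi> \<in> \<Psi>" "represents d \<psi>" using bs(3) by blast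
  then have "\<psi> = \<phi>" using character_eq_iff_gauge_equiv d(2) es(2) char \<phi> by blast
  then show "\<phi> \<in> \<Psi>" using \<psi>(1) by simp
qed

lemma TLJ_form_unique:
  assumes Q: "\<And>n. n > 0 \<Longrightarrow> (of_nat n :: 'r) dvd 1"
    and \<Phi>: "TLJ_form scale D \<Phi> E" and \<Psi>: "TLJ_form scale D \<Psi> F"
  shows "\<Phi> = \<Psi>" and "\<phi> \<in> \<Phi> \<Longrightarrow> E \<phi> = F \<phi>"
proof -
  show eq: "\<Phi> = \<Psi>"
    using TLJ_form_characters_subset[OF \<Phi> \<Psi>] TLJ_form_characters_subset[OF \<Psi> \<Phi>] by blast
  assume \<phi>: "\<phi> \<in> \<Phi>"
  obtain f q0 where f: "represents f \<phi>"
    "\<And>q. q \<ge> q0 \<Longrightarrow> E \<phi> = subconnection scale D hull ker_power scale D f q"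
    using TLJ_form_hull[OF \<Phi> \<phi>] by blast
  obtain g q1 where g: "represents g \<phi>"
    "\<And>q. q \<ge> q1 \<Longrightarrow> F \<phi> = subconnection scale D hull ker_power scale D g q"
    using TLJ_form_hull[OF \<Psi> \<phi>[unfolded eq]] by blast
  have "\<phi> \<in> characters" using \<Phi> \<phi> by (auto simp: TLJ_form_def TLJ_decomposition_def)
  then have "gauge_equiv f g" using character_eq_iff_gauge_equiv f(1) g(1) by blast
  from subconnection_hull_ker_power_gauge[OF Q this, of "max q0 q1"]
  show "E \<phi> = F \<phi>" using f(2)[of "max q0 q1"] g(2)[of "max q0 q1"] by simp
qed

text \<open>
  The vectors of the second basis lie in the eigenspaces of \<open>P\<close> for the eigenvalues that \<open>P'\<close>
  has on them.
\<close>

lemma polar_part_unique: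
  assumes P: "Modules.module_hom scale scale P" and P': "Modules.module_hom scale scale P'"
    and es: "ordered_basis scale UNIV es" "jordan_chain scale D es ds"
    and es': "ordered_basis scale UNIV es'" "jordan_chain scale D es' ds'"
    and polar: "\<And>i. i < length es \<Longrightarrow>
      \<exists>c. \<exists>g\<in>xinv_Rxinv. ds ! i = fls_const c + g \<and> P (es ! i) = scale g (es ! i)"
    and polar': "\<And>i. i < length es' \<Longrightarrow>
      \<exists>c. \<exists>g\<in>xinv_Rxinv. ds' ! i = fls_const c + g \<and> P' (es' ! i) = scale g (es' ! i)"
  shows "P = P'"
proof
  interpret P: Modules.module_hom scale scale P by (rule P)
  interpret P': Modules.module_hom scale scale P' by (rule P')
  have eq: "P b = P' b" if "b \<in> set es'" for b
  proof -
    obtain j where j: "j < length es'" "b = es' ! j" using \<open>b \<in> set es'\<close> by (metis in_set_conv_nth)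
    obtain c' g' where g': "g' \<in> xinv_Rxinv" "ds' ! j = fls_const c' + g'" "P' b = scale g' b"
      using polar'[OF j(1)] j(2) by blast
    have "b \<in> span {es ! i | i. i < length es \<and> gauge_equiv (ds ! i) (ds' ! j)}"
      using ker_power_subset_span[OF es] jordan_chain_kernel[OF es'(2) j(1)] j(2) by blast
    moreover have "subspace {v. P v = scale g' v}"
      by (auto simp: subspace_def P.add P.scale algebra_simps)
    moreover have "{es ! i | i. i < length es \<and> gauge_equiv (ds ! i) (ds' ! j)} \<subseteq> {v. P v = scale g' v}"
    proof clarify
      fix i assume i: "i < length es" "gauge_equiv (ds ! i) (ds' ! j)"
      obtain c g where g: "g \<in> xinv_Rxinv" "ds ! i = fls_const c + g" "P (es ! i) = scale g (es ! i)"
        using polar[OF i(1)] by blast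
      then have "g = g'" using gauge_equiv_const_polar(1) g' i(2) by metis
      then show "P (es ! i) = scale g' (es ! i)" using g(3) by simp
    qed
    ultimately have "b \<in> {v. P v = scale g' v}" using span_minimal by blast
    then show ?thesis using g'(3) by simp
  qed
  fix v
  have "v \<in> span (set es')" using es'(1) by (simp add: ordered_basis_def)
  then show "P v = P' v"
    by (induction rule: span_induct_alt) (simp_all add: P.add P'.add P.scale P'.scale eq)
qed

end

section \<open>Regular singularity\<close>

lemma fls_X_power_mult_is_fps:
  fixes f :: "'r::comm_ring_1 fls"
  assumes "- fls_subdegree f \<le> int N"
  shows "fls_X ^ N * f = fps_to_fls (Abs_fps (\<lambda>k. fls_nth f (int k - int N)))"
proof (rule fls_eqI)
  fix k
  show "fls_nth (fls_X ^ N * f) k =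
    fls_nth (fps_to_fls (Abs_fps (\<lambda>k. fls_nth f (int k - int N)))) k"
    using assms by (cases "k < 0") (simp_all add: fls_X_power_times_conv_shift fls_eq0_below_subdegree)
qed

context theta_connection
begin

text \<open>
  The model is the \<open>R[[x]]\<close>-span of the basis, given by its coordinates: its elements are the
  singletons \<open>{u}\<close> of families \<open>u\<close> of power series supported on the indices of basis vectors. The
  derivation \<open>\<delta>\<close> is \<open>D\<close> in these coordinates, so that its properties follow from those of \<open>D\<close> by
  injectivity of the coordinate map.
\<close>

lemma MC_rs_if_integral_chain:
  assumes MC: "MC scale D" and basis: "ordered_basis scale UNIV es"
    and chain: "jordan_chain scale D es ds" and ds: "set ds \<subseteq> range fps_to_fls"
  shows "MC_rs scale D"
proof -
  let ?n = "length es"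
  define V where "V = {u :: nat \<Rightarrow> 'r fps. \<forall>i\<ge>?n. u i = 0}"
  define lin where "lin u = (\<Sum>i<?n. scale (fps_to_fls (u i)) (es ! i))" for u :: "nat \<Rightarrow> 'r fps"
  have lin_add: "lin (\<lambda>i. u i + u' i) = lin u + lin u'" for u u'
    by (simp add: lin_def sum.distrib scale_left_distrib)
  have lin_diff: "lin (\<lambda>i. u i - u' i) = lin u - lin u'" for u u'
    by (simp add: lin_def sum_subtractf scale_left_diff_distrib)
  have lin_smult: "lin (\<lambda>i. f * u i) = scale (fps_to_fls f) (lin u)" for f u
    by (simp add: lin_def scale_sum_right fls_times_fps_to_fls)
  have lin_0: "u = (\<lambda>i. 0)" if "u \<in> V" "lin u = 0" for u
  proof
    fix i show "u i = 0"
    proof (cases "i < ?n")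
      case True
      have "fps_to_fls (u i) = 0"
        by (rule ordered_basis_coeff_eq_0[OF basis _ True]) (use that(2) lin_def in simp)
      then show ?thesis by simp
    qed (use that(1) V_def in simp)
  qed
  have lin_inj: "u = u'" if "u \<in> V" "u' \<in> V" "lin u = lin u'" for u u'
  proof -
    have "(\<lambda>i. u i - u' i) = (\<lambda>i. 0)"
      by (rule lin_0) (use that lin_diff V_def in auto)
    then show ?thesis by (auto simp: fun_eq_iff)
  qed
  have V_closed: "(\<lambda>i. u i + u' i) \<in> V" "(\<lambda>i. f * u i) \<in> V" "(\<lambda>i. 0) \<in> V" "(\<lambda>i. - u i) \<in> V"
    if "u \<in> V" "u' \<in> V" for u u' f using that by (auto simp: V_def)
  have 0: "(\<lambda>i. 0) \<in> V" by (simp add: V_def)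
  have unit_V: "(\<lambda>i. if i = k then f else 0) \<in> V" if "k < ?n" for k f using that by (auto simp: V_def)
  have lin_unit: "lin (\<lambda>i. if i = k then f else 0) = scale (fps_to_fls f) (es ! k)"
    if "k < ?n" for k f
  proof -
    have "lin (\<lambda>i. if i = k then f else 0) = (\<Sum>i<?n. if i = k then scale (fps_to_fls f) (es ! k) else 0)"
      unfolding lin_def by (rule sum.cong) auto
    then show ?thesis using that by simp
  qed
  have lattice_unit: "scale (fps_to_fls f) (es ! k) \<in> lin ` V" if "k < ?n" for k f
    unfolding lin_unit[OF that, symmetric] using unit_V[OF that] by (rule imageI)
  have lattice_add: "v + v' \<in> lin ` V" if "v \<in> lin ` V" "v' \<in> lin ` V" for v v'
    using that V_closed(1) lin_add by (metis (no_types, lifting) image_iff)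
  have D_es: "D (es ! j) \<in> lin ` V" if j: "j < ?n" for j
  proof -
    have "ds ! j \<in> set ds" using chain j by (simp add: jordan_chain_def)
    then obtain f where f: "ds ! j = fps_to_fls f" using ds by blast
    have d: "scale (ds ! j) (es ! j) \<in> lin ` V"
      using lattice_unit[OF j, of f] f by simp
    have e: "es ! Suc j \<in> lin ` V" if "Suc j < ?n"
      using lattice_unit[OF that, of 1] by simp
    from chain j have "D (es ! j) = scale (ds ! j) (es ! j) \<or>
        Suc j < ?n \<and> D (es ! j) = scale (ds ! j) (es ! j) + es ! Suc j"
      unfolding jordan_chain_def by blast
    then show ?thesis using d e lattice_add[OF d] by (elim disjE conjE) simp_all
  qed
  have lattice_sum: "(\<Sum>i\<in>I. g i) \<in> lin ` V" if "\<And>i. i \<in> I \<Longrightarrow> g i \<in> lin ` V" "finite I" for g and I :: "nat set"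
    using that(2,1)
  proof (induction I)
    case empty
    have "lin (\<lambda>i. 0) = 0" by (simp add: lin_def)
    then have "0 \<in> lin ` V" using imageI[OF 0, of lin] by simp
    then show ?case by simp
  qed (simp add: lattice_add)
  have D_lin: "\<exists>u'. u' \<in> V \<and> lin u' = D (lin u)" for u
  proof -
    have "D (lin u) = (\<Sum>i<?n. scale (fps_to_fls (theta_fps (u i))) (es ! i) +
        scale (fps_to_fls (u i)) (D (es ! i)))"
      unfolding lin_def by (simp add: D_sum D_scale theta_fls_fps_to_fls)
    moreover have "scale (fps_to_fls (theta_fps (u i))) (es ! i) +
        scale (fps_to_fls (u i)) (D (es ! i)) \<in> lin ` V" if i: "i < ?n" for i
    proof (rule lattice_add)
      show "scale (fps_to_fls (theta_fps (u i))) (es ! i) \<in> lin ` V"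
        by (rule lattice_unit[OF i])
      obtain u' where u': "u' \<in> V" "D (es ! i) = lin u'" using D_es[OF i] by blast
      show "scale (fps_to_fls (u i)) (D (es ! i)) \<in> lin ` V"
        unfolding u'(2) lin_smult[symmetric] using V_closed(2)[OF u'(1) u'(1)] by blast
    qed
    ultimately have "D (lin u) \<in> lin ` V" using lattice_sum[of "{..<?n}"] by simp
    then show ?thesis by (elim imageE) (metis (no_types))
  qed
  define \<delta> where "\<delta> m = {SOME u. u \<in> V \<and> lin u = D (lin (the_elem m))}" for m :: "(nat \<Rightarrow> 'r fps) set"
  have \<delta>: "\<exists>u'\<in>V. \<delta> {u} = {u'} \<and> lin u' = D (lin u)" for u
    using someI_ex[OF D_lin[of u]] by (simp add: \<delta>_def)
  define M :: "('r fps, (nat \<Rightarrow> 'r fps) set) module" where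
    "M = \<lparr>carrier = (\<lambda>u. {u}) ` V, mult = (\<lambda>m m'. {\<lambda>i. 0}), one = {\<lambda>i. 0}, zero = {\<lambda>i. 0},
      add = (\<lambda>m m'. {\<lambda>i. the_elem m i + the_elem m' i}), smult = (\<lambda>f m. {\<lambda>i. f * the_elem m i})\<rparr>"
  have M: "carrier M = (\<lambda>u. {u}) ` V" "zero M = {\<lambda>i. 0}"
    "add M m m' = {\<lambda>i. the_elem m i + the_elem m' i}" "smult M f m = {\<lambda>i. f * the_elem m i}" for m m' f
    by (simp_all add: M_def)
  have module: "Module.module class_ring M"
  proof (rule Module.moduleI)
    show "cring (class_ring :: 'r fps ring)" by (rule class_cring.is_cring)
    show "abelian_group M"
    proof (rule abelian_groupI)
      fix m assume "m \<in> carrier M"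
      then obtain u where u: "u \<in> V" "m = {u}" unfolding M by blast
      show "\<exists>m'\<in>carrier M. m' \<oplus>\<^bsub>M\<^esub> m = \<zero>\<^bsub>M\<^esub>"
        by (rule bexI[of _ "{\<lambda>i. - u i}"]) (use u V_closed in \<open>auto simp: M\<close>)
    qed (use V_closed 0 in \<open>auto simp: M algebra_simps\<close>)
  qed (use V_closed in \<open>auto simp: M algebra_simps\<close>)
  define U where "U = (\<lambda>k. {\<lambda>i. if i = k then 1 else (0 :: 'r fps)}) ` {..<?n}"
  have fg: "fg_module class_ring M"
    unfolding fg_module_def
  proof (intro conjI exI[of _ U] allI impI)
    show "Module.module class_ring M" by (rule module)
    show "finite U" by (simp add: U_def)
    show "U \<subseteq> carrier M" using unit_V by (auto simp: U_def M)
    \<comment> \<open>A submodule containing the unit vectors contains every truncation of every family.\<close>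
    fix N assume N: "Module.submodule N class_ring M \<and> U \<subseteq> N"
    then interpret N: Module.submodule N class_ring M by blast
    have N_add: "{\<lambda>i. u i + u' i} \<in> N" if "{u} \<in> N" "{u'} \<in> N" for u u'
      using N.m_closed[OF that] by (simp add: M)
    have N_smult: "{\<lambda>i. f * u i} \<in> N" if "{u} \<in> N" for f u
      using N.smult_closed[of f, OF _ that] by (simp add: M)
    have N_0: "{\<lambda>i. 0} \<in> N" using N.one_closed by (simp add: M)
    have "{u} \<in> N" if u: "u \<in> V" for u
    proof -
      have "k \<le> ?n \<longrightarrow> {\<lambda>i. if i < k then u i else 0} \<in> N" for k
      proof (induction k)
        case 0
        then show ?case using N_0 by simp
      next
        case (Suc k)
        show ?case
        proof
          assume k: "Suc k \<le> ?n"
          then have "{\<lambda>i. if i < k then u i else 0} \<in> N" using Suc.IH by simp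
          moreover have "{\<lambda>i. if i = k then 1 else 0} \<in> N" using N k by (auto simp: U_def)
          ultimately have "{\<lambda>i. (if i < k then u i else 0) + u k * (if i = k then 1 else 0)} \<in> N"
            by (intro N_add N_smult)
          also have "(\<lambda>i. (if i < k then u i else 0) + u k * (if i = k then 1 else 0))
            = (\<lambda>i. if i < Suc k then u i else 0)"
            by (rule ext) (auto simp: less_Suc_eq)
          finally show "{\<lambda>i. if i < Suc k then u i else 0} \<in> N" .
        qed
      qed
      moreover have "(\<lambda>i. if i < ?n then u i else 0) = u" using u by (auto simp: V_def fun_eq_iff)
      ultimately show ?thesis by (metis order_refl)
    qed
    then show "N = carrier M" using N.subset by (auto simp: M)
  qed
  have log: "log_model M \<delta>"
    unfolding log_model_def
  proof (intro conjI ballI allI fg)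
    show "\<delta> \<in> carrier M \<rightarrow> carrier M" using \<delta> by (fastforce simp: M)
    fix m assume "m \<in> carrier M"
    then obtain u where u: "u \<in> V" "m = {u}" unfolding M by blast
    obtain du where du: "du \<in> V" "\<delta> {u} = {du}" "lin du = D (lin u)" using \<delta> by blast
    {
      fix m' assume "m' \<in> carrier M"
      then obtain u' where u': "u' \<in> V" "m' = {u'}" unfolding M by blast
      obtain du' where du': "du' \<in> V" "\<delta> {u'} = {du'}" "lin du' = D (lin u')" using \<delta> by blast
      obtain w where w: "w \<in> V" "\<delta> {\<lambda>i. u i + u' i} = {w}" "lin w = D (lin (\<lambda>i. u i + u' i))"
        using \<delta> by blast
      have "w = (\<lambda>i. du i + du' i)"
        by (rule lin_inj) (use w du du' V_closed in \<open>simp_all add: lin_add D_add\<close>)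
      then show "\<delta> (m \<oplus>\<^bsub>M\<^esub> m') = \<delta> m \<oplus>\<^bsub>M\<^esub> \<delta> m'"
        using w u u' du du' by (simp add: M)
    }
    have Leibniz: "\<delta> (f \<odot>\<^bsub>M\<^esub> m) = (theta_fps f \<odot>\<^bsub>M\<^esub> m) \<oplus>\<^bsub>M\<^esub> (f \<odot>\<^bsub>M\<^esub> \<delta> m)" for f
    proof -
      obtain w where w: "w \<in> V" "\<delta> {\<lambda>i. f * u i} = {w}" "lin w = D (lin (\<lambda>i. f * u i))"
        using \<delta> by blast
      have "w = (\<lambda>i. theta_fps f * u i + f * du i)"
        by (rule lin_inj)
          (use w u du V_closed in \<open>simp_all add: lin_add lin_smult D_scale theta_fls_fps_to_fls\<close>)
      then show ?thesis using w u du by (simp add: M)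
    qed
    then show "\<delta> (f \<odot>\<^bsub>M\<^esub> m) = (theta_fps f \<odot>\<^bsub>M\<^esub> m) \<oplus>\<^bsub>M\<^esub> (f \<odot>\<^bsub>M\<^esub> \<delta> m)" for f .
    show "\<delta> (fps_const r \<odot>\<^bsub>M\<^esub> m) = fps_const r \<odot>\<^bsub>M\<^esub> \<delta> m" for r
    proof -
      have "theta_fps (fps_const r) = 0" by (simp add: theta_fps_def)
      then show ?thesis using Leibniz[of "fps_const r"] u du by (simp add: M)
    qed
  qed
  have loc: "localization_at_x M scale (\<lambda>m. lin (the_elem m))"
    unfolding localization_at_x_def
  proof (intro conjI ballI allI impI)
    fix v
    have "v \<in> span (set es)" using basis by (simp add: ordered_basis_def)
    then obtain c where c: "v = (\<Sum>i<?n. scale (c i) (es ! i))" by (rule list_coeffs_in_span)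
    \<comment> \<open>A power of \<open>x\<close> that clears the denominators of all coordinates.\<close>
    define N where "N = (\<Sum>i<?n. nat (- fls_subdegree (c i)))"
    have N: "- fls_subdegree (c i) \<le> int N" if "i < ?n" for i
    proof -
      have "nat (- fls_subdegree (c i)) \<le> N" unfolding N_def
        by (rule member_le_sum) (use that in auto)
      then show ?thesis by simp
    qed
    define u where "u i = (if i < ?n then Abs_fps (\<lambda>k. fls_nth (c i) (int k - int N)) else 0)" for i
    have "u \<in> V" by (simp add: V_def u_def)
    moreover have "scale (fls_X ^ N) v = lin u"
      unfolding c lin_def scale_sum_right
      by (rule sum.cong) (simp_all add: u_def fls_X_power_mult_is_fps[OF N])
    ultimately show "\<exists>m\<in>carrier M. \<exists>n. scale (fls_X ^ n) v = lin (the_elem m)"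
      by (auto simp: M)
  next
    fix m assume m: "m \<in> carrier M" "lin (the_elem m) = 0"
    then obtain u where u: "u \<in> V" "m = {u}" unfolding M by blast
    with m(2) have "u = (\<lambda>i. 0)" using lin_0 by simp
    then have "fps_X ^ 0 \<odot>\<^bsub>M\<^esub> m = \<zero>\<^bsub>M\<^esub>" using u by (simp add: M)
    then show "\<exists>n. fps_X ^ n \<odot>\<^bsub>M\<^esub> m = \<zero>\<^bsub>M\<^esub>" by blast
  qed (auto simp: M lin_add lin_smult)
  have "lin (the_elem (\<delta> m)) = D (lin (the_elem m))" if m: "m \<in> carrier M" for m
  proof -
    obtain u where u: "m = {u}" using m unfolding M by blast
    obtain u' where "\<delta> {u} = {u'}" "lin u' = D (lin u)" using \<delta> by blast
    then show ?thesis using u by simp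
  qed
  with MC log loc show ?thesis unfolding MC_rs_def by blast
qed

end

section \<open>Normalized characters\<close>

text \<open>
  A chosen element of the coset \<open>c + \<int>\<close>, depending on the coset only.
\<close>

definition integral_translate :: "'r::comm_ring_1 \<Rightarrow> 'r" where
  "integral_translate c = (SOME b. \<exists>n::int. b = c + of_int n)"

lemma integral_translate: "\<exists>n::int. integral_translate c = c + of_int n"
  unfolding integral_translate_def by (rule someI[of _ c]) (auto intro: exI[of _ 0])

lemma integral_translate_cong:
  assumes "c = c' + of_int n" shows "integral_translate c = integral_translate c'"
proof -
  have "(\<exists>k::int. b = c + of_int k) \<longleftrightarrow> (\<exists>k::int. b = c' + of_int k)" for b
  proof
    assume "\<exists>k::int. b = c + of_int k"
    then obtain k where "b = c + of_int k" by blast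
    then have "b = c' + of_int (n + k)" using assms by simp
    then show "\<exists>k::int. b = c' + of_int k" by blast
  next
    assume "\<exists>k::int. b = c' + of_int k"
    then obtain k where "b = c' + of_int k" by blast
    then have "b = c + of_int (k - n)" using assms by simp
    then show "\<exists>k::int. b = c + of_int k" by blast
  qed
  then show ?thesis by (simp add: integral_translate_def)
qed

lemma Rxinv_const: "fls_const c \<in> Rxinv"
  by (simp add: Rxinv_def)

text \<open>
  Split a representative in \<open>R[x\<^sup>-\<^sup>1]\<close> into its constant term, moved by an integer to the chosen
  element of its coset, and its polar part.
\<close>

lemma character_polar_decomposition:
  assumes "\<phi> \<in> characters" "represents f \<phi>"
  shows "\<exists>c. \<exists>g\<in>xinv_Rxinv. gauge_equiv f (fls_const (integral_translate c) + g)"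
proof -
  obtain p where p: "p \<in> Rxinv" "gauge_equiv f p"
    using assms by (auto simp: characters_def represents_gauge_equiv)
  define c where "c = fls_nth p 0"
  define g where "g = p - fls_const c"
  have g: "g \<in> xinv_Rxinv"
    using p(1) by (auto simp: xinv_Rxinv_def Rxinv_def g_def c_def)
  obtain n where n: "integral_translate c = c + of_int n" using integral_translate by blast
  have "p - (fls_const (integral_translate c) + g) - of_int (- n) = 0"
    by (rule fls_eqI) (simp add: n g_def fls_of_int_nth')
  then have "gauge_equiv p (fls_const (integral_translate c) + g)"
    unfolding gauge_equiv_def using zero_in_xRx by metis
  then show ?thesis using g p(2) gauge_equiv_trans by blast
qed

section \<open>The two parts of the decomposition\<close>

definition rs_polar_decomposition ::
  "('r::comm_ring_1 fls \<Rightarrow> 'e::ab_group_add \<Rightarrow> 'e) \<Rightarrow> ('e \<Rightarrow> 'e) \<Rightarrow> ('e \<Rightarrow> 'e) \<Rightarrow> ('e \<Rightarrow> 'e) \<Rightarrow> bool" where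
  "rs_polar_decomposition scale D D0 P \<longleftrightarrow>
    (\<forall>v. D v = D0 v + P v) \<and>
    MC_rs scale D0 \<and> admits_TLJ_form scale D0 \<and>
    Modules.module_hom scale scale P \<and> diagonalizable_end scale P \<and>
    (\<forall>c. eigenvalue_end scale P c \<longrightarrow> c \<in> xinv_Rxinv) \<and>
    (\<forall>\<Sigma> E. TLJ_form scale D0 \<Sigma> E \<longrightarrow>
       \<Sigma> \<subseteq> const_characters \<and>
       (\<forall>\<rho>\<in>\<Sigma>. P ` E \<rho> \<subseteq> E \<rho> \<and>
          (\<exists>es c fs rs. joint_Jflat_form scale D0 D (E \<rho>) es c fs rs)))"

context laurent_module
begin

lemma diagonal_hom_exists:
  assumes es: "ordered_basis scale UNIV es"
  shows "\<exists>P. Modules.module_hom scale scale P \<and> (\<forall>e\<in>set es. P e = scale (\<gamma> e) e)"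
proof -
  have ind: "independent (set es)" and span: "v \<in> span (set es)" for v
    using es by (simp_all add: ordered_basis_def)
  define P where "P v = (\<Sum>b\<in>set es. scale (representation (set es) v b * \<gamma> b) b)" for v
  have "Modules.module_hom scale scale P"
  proof (unfold_locales)
    show "P (v + w) = P v + P w" for v w
      by (simp add: P_def representation_add[OF ind span span] scale_left_distrib distrib_right sum.distrib)
    show "P (scale f v) = scale f (P v)" for f v
      by (simp add: P_def representation_scale[OF ind span] scale_sum_right mult.assoc)
  qed
  moreover have "P e = scale (\<gamma> e) e" if "e \<in> set es" for e
  proof -
    have "P e = (\<Sum>b\<in>set es. if b = e then scale (\<gamma> e) e else 0)"
      unfolding P_def by (rule sum.cong) (use that in \<open>auto simp: representation_basis[OF ind]\<close>)
    then show ?thesis using that by simp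
  qed
  ultimately show ?thesis by blast
qed

lemma eigenvalue_of_diagonal_hom:
  assumes es: "ordered_basis scale UNIV es" and P: "Modules.module_hom scale scale P"
    and diag: "\<And>e. e \<in> set es \<Longrightarrow> \<exists>g\<in>S. P e = scale g e" and k: "eigenvalue_end scale P k"
  shows "k \<in> S"
proof -
  interpret P: Modules.module_hom scale scale P by (rule P)
  obtain v where v: "v \<noteq> 0" "P v = scale k v" using k by (auto simp: eigenvalue_end_def)
  have "v \<in> span (set es)" using es by (simp add: ordered_basis_def)
  then obtain u where u: "v = (\<Sum>i<length es. scale (u i) (es ! i))" by (rule list_coeffs_in_span)
  have "\<exists>i<length es. u i \<noteq> 0"
  proof (rule ccontr)
    assume "\<not> ?thesis"
    then have "v = 0" unfolding u by (intro sum.neutral) auto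
    then show False using v(1) by simp
  qed
  then obtain i where i: "i < length es" "u i \<noteq> 0" by blast
  have "\<forall>j. \<exists>g. j < length es \<longrightarrow> g \<in> S \<and> P (es ! j) = scale g (es ! j)"
    using diag nth_mem by blast
  then obtain g where g: "\<And>j. j < length es \<Longrightarrow> g j \<in> S \<and> P (es ! j) = scale (g j) (es ! j)"
    by metis
  have "(\<Sum>j<length es. scale (u j * (g j - k)) (es ! j)) = P v - scale k v"
    unfolding u P.sum scale_sum_right sum_subtractf[symmetric]
    by (rule sum.cong) (simp_all add: P.scale g algebra_simps)
  also have "\<dots> = 0" using v by simp
  finally have "u i * (g i - k) = 0" by (rule ordered_basis_coeff_eq_0[OF es _ i(1)])
  then have "k = g i" using i(2) by simp
  then show ?thesis using g i(1) by blast
qed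

lemma rs_polar_decomposition_chain:
  assumes "rs_polar_decomposition scale D D0 P"
  obtains es ds where "ordered_basis scale UNIV es" "jordan_chain scale D es ds"
    "\<And>i. i < length es \<Longrightarrow>
      \<exists>c. \<exists>g\<in>xinv_Rxinv. ds ! i = fls_const c + g \<and> P (es ! i) = scale g (es ! i)"
proof -
  obtain \<Sigma> E where form: "TLJ_form scale D0 \<Sigma> E"
    using assms unfolding rs_polar_decomposition_def admits_TLJ_form_def by blast
  then have fin: "finite \<Sigma>" and ds: "direct_sum_family \<Sigma> E"
    by (simp_all add: TLJ_form_def TLJ_decomposition_def)
  have "\<forall>\<rho>\<in>\<Sigma>. \<exists>es ds c. ordered_basis scale (E \<rho>) es \<and> jordan_chain scale D es ds \<and>
    (\<forall>i<length es. \<exists>g\<in>xinv_Rxinv. ds ! i = fls_const c + g \<and> P (es ! i) = scale g (es ! i))"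
  proof
    fix \<rho> assume "\<rho> \<in> \<Sigma>"
    then obtain es c fs rs where joint: "joint_Jflat_form scale D0 D (E \<rho>) es c fs rs"
      using assms form unfolding rs_polar_decomposition_def by blast
    have "D v = D0 v + P v" for v using assms unfolding rs_polar_decomposition_def by blast
    from joint_Jflat_form_chain[OF joint this] obtain ds where "jordan_chain scale D es ds"
      "\<And>i. i < length es \<Longrightarrow> \<exists>g\<in>xinv_Rxinv. ds ! i = fls_const c + g \<and> P (es ! i) = scale g (es ! i)"
      by metis
    moreover have "ordered_basis scale (E \<rho>) es" using joint unfolding joint_Jflat_form_def by blast
    ultimately show "\<exists>es ds c. ordered_basis scale (E \<rho>) es \<and> jordan_chain scale D es ds \<and>
    (\<forall>i<length es. \<exists>g\<in>xinv_Rxinv. ds ! i = fls_const c + g \<and> P (es ! i) = scale g (es ! i))"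
      by blast
  qed
  then obtain es d c where
    *: "\<And>\<rho>. \<rho> \<in> \<Sigma> \<Longrightarrow> ordered_basis scale (E \<rho>) (es \<rho>)" "\<And>\<rho>. \<rho> \<in> \<Sigma> \<Longrightarrow> jordan_chain scale D (es \<rho>) (d \<rho>)"
    "\<And>\<rho> i. \<rho> \<in> \<Sigma> \<Longrightarrow> i < length (es \<rho>) \<Longrightarrow>
      \<exists>g\<in>xinv_Rxinv. d \<rho> ! i = fls_const (c \<rho>) + g \<and> P (es \<rho> ! i) = scale g (es \<rho> ! i)"
    by metis
  obtain \<rho>s where \<rho>s: "set \<rho>s = \<Sigma>" "distinct \<rho>s" using finite_distinct_list[OF fin] by blast
  show thesis
  proof
    show "ordered_basis scale UNIV (concat (map es \<rho>s))"
      by (rule ordered_basis_concat[OF _ \<rho>s(2)]) (use ds \<rho>s(1) *(1) in blast)+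
    show "jordan_chain scale D (concat (map es \<rho>s)) (concat (map d \<rho>s))"
      by (rule jordan_chain_concat) (use \<rho>s(1) *(2) in blast)
    fix i assume i: "i < length (concat (map es \<rho>s))"
    have "length (d \<rho>) = length (es \<rho>)" if "\<rho> \<in> set \<rho>s" for \<rho>
      using *(2)[of \<rho>] that \<rho>s(1) by (simp add: jordan_chain_def)
    from nth_concat_map[OF i this] obtain \<rho> j where "\<rho> \<in> \<Sigma>" "j < length (es \<rho>)"
      "concat (map es \<rho>s) ! i = es \<rho> ! j" "concat (map d \<rho>s) ! i = d \<rho> ! j"
      using \<rho>s(1) by blast
    then show "\<exists>c. \<exists>g\<in>xinv_Rxinv. concat (map d \<rho>s) ! i = fls_const c + g \<and>
        P (concat (map es \<rho>s) ! i) = scale g (concat (map es \<rho>s) ! i)"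
      using *(3) by metis
  qed
qed

end

context theta_connection
begin

lemma D_span_subset:
  assumes "\<And>b. b \<in> B \<Longrightarrow> D b \<in> span B"
  shows "D ` span B \<subseteq> span B"
proof clarify
  fix v assume "v \<in> span B"
  then show "D v \<in> span B"
  proof (induction rule: span_induct_alt)
    case base
    then show ?case by (simp add: span_zero)
  next
    case (step k b v)
    then show ?case by (simp add: D_add D_scale assms span_add span_scale span_base)
  qed
qed

lemma jordan_chain_span_invariant:
  assumes "jordan_chain scale D es ds"
  shows "D ` span (set es) \<subseteq> span (set es)"
proof (rule D_span_subset)
  fix b assume "b \<in> set es"
  then obtain j where j: "j < length es" "b = es ! j" by (metis in_set_conv_nth)
  then have "D b = scale (ds ! j) b \<or> Suc j < length es \<and> D b = scale (ds ! j) b + es ! Suc j"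
    using assms unfolding jordan_chain_def by blast
  moreover have "scale (ds ! j) b \<in> span (set es)" using \<open>b \<in> set es\<close> by (simp add: span_base span_scale)
  moreover have "es ! Suc j \<in> span (set es)" if "Suc j < length es" using that by (simp add: span_base)
  ultimately show "D b \<in> span (set es)" by (auto intro: span_add)
qed

text \<open>
  Multiplying a basis by a unit \<open>w\<close> with \<open>\<vartheta> w = (g - f) w\<close> adds \<open>g - f\<close> to the diagonal and leaves the
  entries below it unchanged.
\<close>

lemma regauge_Jflat:
  assumes Q: "\<And>n. n > 0 \<Longrightarrow> (of_nat n :: 'r) dvd 1"
    and es: "ordered_basis scale W es" and A: "is_Jflat (length es) f A" "has_Mat scale D es A"
    and fg: "gauge_equiv f g"
  shows "\<exists>es' A'. ordered_basis scale W es' \<and> is_Jflat (length es') g A' \<and> has_Mat scale D es' A'"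
proof -
  have "gauge_equiv (g - f) 0" using fg by (simp add: gauge_equiv_0_diff gauge_equiv_sym)
  from theta_eigenvector_unit[OF Q this] obtain w w' where
    w: "w * w' = 1" "theta_fls w = (g - f) * w" by metis
  let ?es = "map (scale w) es"
  have "is_Jflat (length ?es) (f + (g - f)) (A + (g - f) \<cdot>\<^sub>m 1\<^sub>m (length es))"
    unfolding length_map by (rule is_Jflat_add_scalar[OF A(1)])
  moreover have "has_Mat scale D ?es (A + (g - f) \<cdot>\<^sub>m 1\<^sub>m (length es))"
    by (rule has_Mat_add_scalar[OF A(2) _ refl]) (simp add: D_scale w(2))
  ultimately show ?thesis 
    using ordered_basis_map_unit[OF es w(1)] by (intro exI[of _ ?es] exI conjI) simp_all
qed

end

text \<open>
  The situation after normalization: each summand, labelled by some \<open>i\<close>, has a basis \<open>L i\<close> in which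
  \<open>D\<close> is a Jordan matrix with diagonal entry exactly \<open>c i + g i\<close>, constants congruent modulo \<open>\<int>\<close> are
  equal, and \<open>P\<close> acts as \<open>g i\<close>. In this situation \<open>D - P\<close> is the regular-singular part.
\<close>

locale normalized_TLJ = theta_connection scale D
  for scale :: "'r::idom fls \<Rightarrow> 'e::ab_group_add \<Rightarrow> 'e" and D :: "'e \<Rightarrow> 'e" +
  fixes xs :: "'i list" and L :: "'i \<Rightarrow> 'e list" and A :: "'i \<Rightarrow> 'r fls mat"
    and c :: "'i \<Rightarrow> 'r" and g :: "'i \<Rightarrow> 'r fls" and P :: "'e \<Rightarrow> 'e"
  assumes basis: "ordered_basis scale UNIV (concat (map L xs))"
    and nonempty: "i \<in> set xs \<Longrightarrow> L i \<noteq> []"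
    and Jflat: "i \<in> set xs \<Longrightarrow> is_Jflat (length (L i)) (fls_const (c i) + g i) (A i)"
    and Mat: "i \<in> set xs \<Longrightarrow> has_Mat scale D (L i) (A i)"
    and polar: "i \<in> set xs \<Longrightarrow> g i \<in> xinv_Rxinv"
    and normal: "i \<in> set xs \<Longrightarrow> j \<in> set xs \<Longrightarrow> c i = c j + of_int n \<Longrightarrow> c i = c j"
    and hom_P: "Modules.module_hom scale scale P"
    and P_basis: "i \<in> set xs \<Longrightarrow> e \<in> set (L i) \<Longrightarrow> P e = scale (g i) e"
begin

sublocale P: Modules.module_hom scale scale P by (rule hom_P)

definition D0 :: "'e \<Rightarrow> 'e" where "D0 v = D v - P v"

sublocale D0: theta_connection scale D0
  by unfold_locales (simp_all add: D0_def D_add D_scale P.add P.scale algebra_simps)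

definition A0 :: "'i \<Rightarrow> 'r fls mat" where "A0 i = A i + (- g i) \<cdot>\<^sub>m 1\<^sub>m (length (L i))"

lemma Jflat_A0: "i \<in> set xs \<Longrightarrow> is_Jflat (length (L i)) (fls_const (c i)) (A0 i)"
  using is_Jflat_add_scalar[OF Jflat, of i "- g i"] by (simp add: A0_def)

lemma Mat_A0: "i \<in> set xs \<Longrightarrow> has_Mat scale D0 (L i) (A0 i)"
  unfolding A0_def
  by (rule has_Mat_add_scalar[OF Mat, where w = 1]) (simp_all add: D0_def P_basis map_idI)

definition char_of :: "'i \<Rightarrow> 'r fls set" where "char_of i = Z_coset (fls_const (c i))"

definition members :: "'r fls set \<Rightarrow> 'i list" where
  "members \<rho> = filter (\<lambda>i. char_of i = \<rho>) xs"

definition class_basis :: "'r fls set \<Rightarrow> 'e list" where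
  "class_basis \<rho> = concat (map L (members \<rho>))"

lemma set_members: "set (members \<rho>) = {i \<in> set xs. char_of i = \<rho>}"
  by (simp add: members_def)

lemma char_of_eq_iff:
  assumes "i \<in> set xs" "j \<in> set xs" shows "char_of i = char_of j \<longleftrightarrow> c i = c j"
proof
  assume "char_of i = char_of j"
  then have "represents (fls_const (c i)) (Z_coset (fls_const (c j)))"
    using represents_gauge_equiv gauge_equiv_refl unfolding char_of_def by metis
  then have "gauge_equiv (fls_const (c i)) (fls_const (c j))" by (simp add: represents_gauge_equiv)
  then show "c i = c j"
    using gauge_equiv_const_polar(2)[of 0 0 "c i" "c j"] normal[OF assms] by (auto simp: xinv_Rxinv_def)
qed (simp add: char_of_def)

lemma class_basis: "ordered_basis scale (span (set (class_basis \<rho>))) (class_basis \<rho>)"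
proof -
  have "distinct (concat (map L xs))" "independent (set (concat (map L xs)))"
    using basis by (simp_all add: ordered_basis_def)
  moreover have "set (class_basis \<rho>) \<subseteq> set (concat (map L xs))"
    by (auto simp: class_basis_def set_members)
  ultimately show ?thesis
    using distinct_concat_map_filter independent_mono
    unfolding ordered_basis_def class_basis_def members_def by blast
qed

lemma class_basis_nonempty: "i \<in> set xs \<Longrightarrow> class_basis (char_of i) \<noteq> []"
  using nonempty[of i] by (auto simp: class_basis_def set_members)

lemma chain_D0:
  assumes "set ys \<subseteq> set xs"
  shows "jordan_chain scale D0 (concat (map L ys))
    (concat (map (\<lambda>i. replicate (length (L i)) (fls_const (c i))) ys))"
  by (rule jordan_chain_concat) (use assms has_Mat_Jflat_chain Mat_A0 Jflat_A0 in blast)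

lemma class_basis_in_kernel:
  assumes i: "i \<in> set xs" and b: "b \<in> set (class_basis (char_of i))"
  shows "b \<in> ker_power scale D0 (fls_const (c i)) (length (class_basis (char_of i)))"
proof -
  let ?ys = "members (char_of i)"
  let ?ds = "\<lambda>k. replicate (length (L k)) (fls_const (c k))"
  obtain j where j: "j < length (class_basis (char_of i))" "b = class_basis (char_of i) ! j"
    using b by (metis in_set_conv_nth)
  obtain k l where k: "k \<in> set ?ys" "l < length (L k)" "concat (map ?ds ?ys) ! j = ?ds k ! l"
    using nth_concat_map[of j L ?ys ?ds] j(1) by (auto simp: class_basis_def)
  then have "concat (map ?ds ?ys) ! j = fls_const (c i)"
    using char_of_eq_iff[OF _ i, of k] by (simp add: set_members)
  moreover have "set ?ys \<subseteq> set xs" by (auto simp: set_members)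
  ultimately show ?thesis
    using D0.jordan_chain_kernel[OF chain_D0, of ?ys j] j unfolding class_basis_def by metis
qed

text \<open>
  The diagonal entries of \<open>D0\<close> are constants, and two of them define the same character
  only if they are equal.
\<close>

lemma kernel_subset_class_span:
  assumes i: "i \<in> set xs"
  shows "ker_power scale D0 (fls_const (c i)) q \<subseteq> span (set (class_basis (char_of i)))"
proof -
  let ?ds = "\<lambda>k. replicate (length (L k)) (fls_const (c k))"
  let ?S = "{concat (map L xs) ! j | j. j < length (concat (map L xs)) \<and>
    gauge_equiv (concat (map ?ds xs) ! j) (fls_const (c i))}"
  have "?S \<subseteq> set (class_basis (char_of i))"
  proof clarify
    fix j assume j: "j < length (concat (map L xs))"
      "gauge_equiv (concat (map ?ds xs) ! j) (fls_const (c i))"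
    obtain k l where k: "k \<in> set xs" "l < length (L k)" "concat (map ?ds xs) ! j = ?ds k ! l"
      "concat (map L xs) ! j = L k ! l"
      using nth_concat_map[of j L xs ?ds] j(1) by auto
    then have "gauge_equiv (fls_const (c k)) (fls_const (c i))" using j(2) by simp
    then have "char_of k = char_of i"
      unfolding char_of_def by (intro gauge_equiv_imp_Z_coset_eq Rxinv_const)
    then show "concat (map L xs) ! j \<in> set (class_basis (char_of i))"
      using k by (auto simp: class_basis_def set_members)
  qed
  then show ?thesis
    using D0.ker_power_subset_span[OF basis chain_D0[OF subset_refl]] span_mono by blast
qed

lemma TLJ_decomposition_D0:
  "TLJ_decomposition scale D0 (char_of ` set xs) (\<lambda>\<rho>. span (set (class_basis \<rho>)))"
  unfolding TLJ_decomposition_def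
proof (intro conjI ballI)
  show "finite (char_of ` set xs)" by simp
  show "char_of ` set xs \<subseteq> characters"
    using Rxinv_const by (auto simp: char_of_def characters_def)
  have un: "(\<Union>\<rho>\<in>char_of ` set xs. set (class_basis \<rho>)) = set (concat (map L xs))"
    by (auto simp: class_basis_def set_members)
  have dist: "distinct (concat (map L xs))" using basis by (simp add: ordered_basis_def)
  show "direct_sum_family (char_of ` set xs) (\<lambda>\<rho>. span (set (class_basis \<rho>)))"
  proof (rule direct_sum_family_span)
    show "independent (\<Union>\<rho>\<in>char_of ` set xs. set (class_basis \<rho>))"
      "span (\<Union>\<rho>\<in>char_of ` set xs. set (class_basis \<rho>)) = UNIV"
      unfolding un using basis by (simp_all add: ordered_basis_def)
    show "set (class_basis \<rho>) \<inter> set (class_basis \<sigma>) = {}" if "\<rho> \<noteq> \<sigma>" for \<rho> \<sigma>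
    proof (rule ccontr)
      assume "\<not> ?thesis"
      then obtain i j e where "i \<in> set xs" "char_of i = \<rho>" "e \<in> set (L i)"
        "j \<in> set xs" "char_of j = \<sigma>" "e \<in> set (L j)"
        by (auto simp: class_basis_def set_members)
      then show False using distinct_concat_map_disjoint[OF dist, of i j] that by blast
    qed
  qed simp_all
  fix \<rho> assume "\<rho> \<in> char_of ` set xs"
  then obtain i where i: "i \<in> set xs" "\<rho> = char_of i" by blast
  let ?B = "set (class_basis \<rho>)"
  obtain e where e: "e \<in> ?B" using class_basis_nonempty[OF i(1)] i(2) by (metis list.set_intros(1) neq_Nil_conv)
  have "e \<noteq> 0" using class_basis[of \<rho>] e dependent_zero unfolding ordered_basis_def by blast
  then show "span ?B \<noteq> {0}" using span_base[OF e] by blast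
  have chain: "jordan_chain scale D0 (class_basis \<rho>)
      (concat (map (\<lambda>i. replicate (length (L i)) (fls_const (c i))) (members \<rho>)))"
    unfolding class_basis_def by (rule chain_D0) (auto simp: set_members)
  have "span ?B = subconnection scale D0 hull ker_power scale D0 (fls_const (c i)) q"
    if "q \<ge> length (class_basis \<rho>)" for q
  proof (rule hull_unique[symmetric])
    show "ker_power scale D0 (fls_const (c i)) q \<subseteq> span ?B"
      using kernel_subset_class_span[OF i(1)] i(2) by simp
    show "subconnection scale D0 (span ?B)"
      using D0.jordan_chain_span_invariant[OF chain] by (simp add: subconnection_def)
    fix W assume W: "ker_power scale D0 (fls_const (c i)) q \<subseteq> W" "subconnection scale D0 W"
    have "?B \<subseteq> ker_power scale D0 (fls_const (c i)) q"
      using D0.ker_power_mono[OF class_basis_in_kernel[OF i(1)] that[unfolded i(2)]] i(2) by blast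
    then have "?B \<subseteq> W" using W(1) by (rule subset_trans)
    then show "span ?B \<subseteq> W"
      by (rule span_minimal) (use W(2) in \<open>simp add: subconnection_def\<close>)
  qed
  moreover have "represents (fls_const (c i)) \<rho>"
    by (simp add: i(2) char_of_def represents_gauge_equiv gauge_equiv_refl)
  ultimately show "\<exists>f. represents f \<rho> \<and>
    (\<exists>q0. \<forall>q\<ge>q0. span ?B = subconnection scale D0 hull ker_power scale D0 f q)" by blast
qed

lemma class_basis_Mat:
  assumes i: "i \<in> set xs"
  defines "ys \<equiv> members (char_of i)"
  shows "has_Mat scale D0 (class_basis (char_of i)) (diag_block_mat (map A0 ys))"
    and "has_Mat scale D (class_basis (char_of i)) (diag_block_mat (map A ys))"
    and "is_Jflat (length (class_basis (char_of i))) (fls_const (c i)) (diag_block_mat (map A0 ys))"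
    and "same_off_diagonal (diag_block_mat (map A0 ys)) (diag_block_mat (map A ys))"
proof -
  have ys: "j \<in> set xs" "c j = c i" if "j \<in> set ys" for j
    using that char_of_eq_iff[OF _ i, of j] by (simp_all add: ys_def set_members)
  show Mat0: "has_Mat scale D0 (class_basis (char_of i)) (diag_block_mat (map A0 ys))"
    unfolding class_basis_def ys_def[symmetric] by (rule has_Mat_concat) (use ys Mat_A0 in blast)
  show "has_Mat scale D (class_basis (char_of i)) (diag_block_mat (map A ys))"
    unfolding class_basis_def ys_def[symmetric] by (rule has_Mat_concat) (use ys Mat in blast)
  have "jordan_shaped {fls_const (c i)} (diag_block_mat (map A0 ys))"
  proof (rule jordan_shaped_diag_block_mat)
    fix B assume "B \<in> set (map A0 ys)"
    then obtain j where j: "j \<in> set ys" "B = A0 j" by auto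
    show "jordan_shaped {fls_const (c i)} B"
      using jordan_shaped_if_is_Jflat[OF Jflat_A0[OF ys(1)[OF j(1)]]] j ys(2) by simp
  qed
  from is_Jflat_if_jordan_shaped[OF this]
  show "is_Jflat (length (class_basis (char_of i))) (fls_const (c i)) (diag_block_mat (map A0 ys))"
    unfolding has_Mat_dim(1)[OF Mat0] .
  show "same_off_diagonal (diag_block_mat (map A0 ys)) (diag_block_mat (map A ys))"
  proof (rule same_off_diagonal_diag_block_mat)
    fix j assume "j \<in> set ys"
    then have "A j \<in> carrier_mat (length (L j)) (length (L j))"
      using Jflat[OF ys(1)] unfolding is_Jflat_def by blast
    then show "same_off_diagonal (A0 j) (A j)"
      unfolding A0_def by (rule same_off_diagonal_add_scalar)
  qed
qed

lemma TLJ_form_D0: "TLJ_form scale D0 (char_of ` set xs) (\<lambda>\<rho>. span (set (class_basis \<rho>)))"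
  unfolding TLJ_form_def
proof (intro conjI TLJ_decomposition_D0 ballI)
  fix \<rho> assume "\<rho> \<in> char_of ` set xs"
  then obtain i where i: "i \<in> set xs" "\<rho> = char_of i" by blast
  have "represents (fls_const (c i)) \<rho>"
    by (simp add: i(2) char_of_def represents_gauge_equiv gauge_equiv_refl)
  then show "\<exists>es f A. ordered_basis scale (span (set (class_basis \<rho>))) es \<and> represents f \<rho> \<and>
        is_Jflat (length es) f A \<and> has_Mat scale D0 es A"
    using class_basis class_basis_Mat(1,3)[OF i(1)] i(2) by blast
qed

lemma joint_form_class:
  assumes i: "i \<in> set xs"
  shows "joint_Jflat_form scale D0 D (span (set (class_basis (char_of i)))) (class_basis (char_of i))
    (c i) (map g (members (char_of i))) (map (\<lambda>j. length (L j)) (members (char_of i)))"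
proof -
  let ?ys = "members (char_of i)" and ?es = "class_basis (char_of i)"
  let ?S = "diag_block_mat (map A0 ?ys)" and ?T = "diag_block_mat (map A ?ys)"
  have ys: "j \<in> set xs" "c j = c i" if "j \<in> set ?ys" for j
    using that char_of_eq_iff[OF _ i, of j] by (simp_all add: set_members)
  have blocks: "\<forall>k<length (map g ?ys). is_Jflat (map (\<lambda>j. length (L j)) ?ys ! k)
      (fls_const (c i) + map g ?ys ! k) (map A ?ys ! k)"
  proof (intro allI impI)
    fix k assume "k < length (map g ?ys)"
    then have k: "k < length ?ys" and m: "?ys ! k \<in> set ?ys" by simp_all
    from Jflat[OF ys(1)[OF m]] ys(2)[OF m] k
    show "is_Jflat (map (\<lambda>j. length (L j)) ?ys ! k) (fls_const (c i) + map g ?ys ! k) (map A ?ys ! k)"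
      by simp
  qed
  have off: "\<forall>k<length ?es. \<forall>l<length ?es. k \<noteq> l \<longrightarrow> ?S $$ (k, l) = ?T $$ (k, l)"
    using class_basis_Mat(4)[OF i] has_Mat_dim[OF class_basis_Mat(1)[OF i]]
    unfolding same_off_diagonal_def by metis
  have fs: "set (map g ?ys) \<subseteq> xinv_Rxinv" using polar ys(1) by auto
  have rs: "\<forall>r\<in>set (map (\<lambda>j. length (L j)) ?ys). r > 0" using nonempty ys(1) by auto
  have ne: "length ?es > 0" using class_basis_nonempty[OF i] by simp
  have len: "length (map (\<lambda>j. length (L j)) ?ys) = length (map g ?ys)"
    "length (map A ?ys) = length (map g ?ys)" by simp_all
  show ?thesis
    unfolding joint_Jflat_form_def
    by (intro conjI exI[of _ ?S] exI[of _ "map A ?ys"])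
      (rule class_basis class_basis_Mat(1-3)[OF i] fs rs ne len blocks off)+
qed

lemma P_class_span: "P ` span (set (class_basis \<rho>)) \<subseteq> span (set (class_basis \<rho>))"
proof -
  have "P b \<in> span (set (class_basis \<rho>))" if b: "b \<in> set (class_basis \<rho>)" for b
  proof -
    obtain j where "j \<in> set xs" "b \<in> set (L j)" 
      using b by (auto simp: class_basis_def set_members)
    then show ?thesis using span_scale[OF span_base[OF b]] P_basis by metis
  qed
  then have "P ` set (class_basis \<rho>) \<subseteq> span (set (class_basis \<rho>))" by blast
  then show ?thesis
    using span_minimal[of "P ` set (class_basis \<rho>)"] P.span_image[of "set (class_basis \<rho>)"] by simp
qed

text \<open>
  The conditions on arbitrary TLJ-forms of \<open>D0\<close> reduce to the one constructed here, by
  uniqueness of the TLJ-decomposition.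
\<close>

lemma rs_polar_decomposition_D0:
  assumes Q: "\<And>n. n > 0 \<Longrightarrow> (of_nat n :: 'r) dvd 1" and MC: "MC scale D"
  shows "rs_polar_decomposition scale D D0 P"
  unfolding rs_polar_decomposition_def
proof (intro conjI allI impI)
  show "D v = D0 v + P v" for v by (simp add: D0_def)
  have MC0: "MC scale D0"
    using MC unfolding MC_def by (simp add: D0.D_add D0.D_scale)
  show "MC_rs scale D0"
  proof (rule D0.MC_rs_if_integral_chain[OF MC0 basis chain_D0[OF subset_refl]])
    have "fls_const r \<in> range fps_to_fls" for r :: 'r by (metis fps_const_to_fls rangeI)
    then show "set (concat (map (\<lambda>i. replicate (length (L i)) (fls_const (c i))) xs)) \<subseteq> range fps_to_fls"
      by auto
  qed
  show "admits_TLJ_form scale D0" using TLJ_form_D0 unfolding admits_TLJ_form_def by blast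
  show "Modules.module_hom scale scale P" by (rule hom_P)
  have diag: "\<exists>k\<in>xinv_Rxinv. P e = scale k e" if "e \<in> set (concat (map L xs))" for e
    using that P_basis polar by fastforce
  then show "diagonalizable_end scale P" using basis unfolding diagonalizable_end_def by blast
  show "k \<in> xinv_Rxinv" if "eigenvalue_end scale P k" for k
    by (rule eigenvalue_of_diagonal_hom[OF basis hom_P diag that])
  fix \<Sigma> E assume form: "TLJ_form scale D0 \<Sigma> E"
  have \<Sigma>: "\<Sigma> = char_of ` set xs" by (rule D0.TLJ_form_unique(1)[OF Q form TLJ_form_D0])
  have E: "E \<rho> = span (set (class_basis \<rho>))" if "\<rho> \<in> \<Sigma>" for \<rho>
    by (rule D0.TLJ_form_unique(2)[OF Q form TLJ_form_D0 that])
  show "\<Sigma> \<subseteq> const_characters" unfolding \<Sigma> by (auto simp: char_of_def const_characters_def)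
  show "\<forall>\<rho>\<in>\<Sigma>. P ` E \<rho> \<subseteq> E \<rho> \<and> (\<exists>es c fs rs. joint_Jflat_form scale D0 D (E \<rho>) es c fs rs)"
  proof
    fix \<rho> assume \<rho>: "\<rho> \<in> \<Sigma>"
    then obtain i where "i \<in> set xs" "\<rho> = char_of i" using \<Sigma> by blast
    then show "P ` E \<rho> \<subseteq> E \<rho> \<and> (\<exists>es c fs rs. joint_Jflat_form scale D0 D (E \<rho>) es c fs rs)"
      unfolding E[OF \<rho>] using P_class_span joint_form_class by blast
  qed
qed

end

context theta_connection
begin

lemma rs_polar_decomposition_exists:
  assumes Q: "\<And>n. n > 0 \<Longrightarrow> (of_nat n :: 'r) dvd 1" and MC: "MC scale D"
    and form: "TLJ_form scale D \<Phi> E"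
  shows "\<exists>D0 P. rs_polar_decomposition scale D D0 P"
proof -
  have fin: "finite \<Phi>" and char: "\<Phi> \<subseteq> characters" and ds: "direct_sum_family \<Phi> E"
    and E0: "\<And>\<phi>. \<phi> \<in> \<Phi> \<Longrightarrow> E \<phi> \<noteq> {0}"
    using form by (simp_all add: TLJ_form_def TLJ_decomposition_def)
  have "\<forall>\<phi>\<in>\<Phi>. \<exists>es A c g. g \<in> xinv_Rxinv \<and> ordered_basis scale (E \<phi>) es \<and>
    is_Jflat (length es) (fls_const (integral_translate c) + g) A \<and> has_Mat scale D es A"
  proof
    fix \<phi> assume \<phi>: "\<phi> \<in> \<Phi>"
    obtain es f A where es: "ordered_basis scale (E \<phi>) es" "represents f \<phi>"
      "is_Jflat (length es) f A" "has_Mat scale D es A"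
      using bspec[OF conjunct2[OF form[unfolded TLJ_form_def]] \<phi>] by (elim exE conjE)
    obtain c g where g: "g \<in> xinv_Rxinv" "gauge_equiv f (fls_const (integral_translate c) + g)"
      using character_polar_decomposition[OF _ es(2)] char \<phi> by blast
    show "\<exists>es A c g. g \<in> xinv_Rxinv \<and> ordered_basis scale (E \<phi>) es \<and>
      is_Jflat (length es) (fls_const (integral_translate c) + g) A \<and> has_Mat scale D es A"
      using regauge_Jflat[OF Q es(1,3,4) g(2)] g(1) by blast
  qed
  then obtain L A c g where *: "\<And>\<phi>. \<phi> \<in> \<Phi> \<Longrightarrow> g \<phi> \<in> xinv_Rxinv"
    "\<And>\<phi>. \<phi> \<in> \<Phi> \<Longrightarrow> ordered_basis scale (E \<phi>) (L \<phi>)"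
    "\<And>\<phi>. \<phi> \<in> \<Phi> \<Longrightarrow> is_Jflat (length (L \<phi>)) (fls_const (integral_translate (c \<phi>)) + g \<phi>) (A \<phi>)"
    "\<And>\<phi>. \<phi> \<in> \<Phi> \<Longrightarrow> has_Mat scale D (L \<phi>) (A \<phi>)"
    by metis
  obtain \<phi>s where \<phi>s: "set \<phi>s = \<Phi>" "distinct \<phi>s" using finite_distinct_list[OF fin] by blast
  have basis: "ordered_basis scale UNIV (concat (map L \<phi>s))"
    by (rule ordered_basis_concat[OF _ \<phi>s(2)]) (use ds \<phi>s(1) *(2) in blast)+
  have dist: "distinct (concat (map L \<phi>s))" using basis by (simp add: ordered_basis_def)
  define \<gamma> where "\<gamma> e = g (THE \<phi>. \<phi> \<in> set \<phi>s \<and> e \<in> set (L \<phi>))" for e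
  have \<gamma>: "\<gamma> e = g \<phi>" if "\<phi> \<in> set \<phi>s" "e \<in> set (L \<phi>)" for \<phi> e
  proof -
    have "(THE \<phi>. \<phi> \<in> set \<phi>s \<and> e \<in> set (L \<phi>)) = \<phi>"
      by (rule the_equality) (use that distinct_concat_map_disjoint[OF dist] in blast)+
    then show ?thesis by (simp add: \<gamma>_def)
  qed
  obtain P where P: "Modules.module_hom scale scale P"
    "\<And>e. e \<in> set (concat (map L \<phi>s)) \<Longrightarrow> P e = scale (\<gamma> e) e"
    using diagonal_hom_exists[OF basis, of \<gamma>] by blast
  interpret hom: Modules.module_hom scale scale P by (rule P(1))
  interpret normalized_TLJ scale D \<phi>s L A "\<lambda>\<phi>. integral_translate (c \<phi>)" g P
  proof unfold_locales
    show "L \<phi> \<noteq> []" if "\<phi> \<in> set \<phi>s" for \<phi>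
      using *(2)[of \<phi>] E0[of \<phi>] that \<phi>s(1) span_empty unfolding ordered_basis_def
      by (metis list.set(1))
    show "integral_translate (c \<phi>) = integral_translate (c \<psi>)"
      if "integral_translate (c \<phi>) = integral_translate (c \<psi>) + of_int n" for \<phi> \<psi> n
    proof -
      obtain k l where "integral_translate (c \<phi>) = c \<phi> + of_int k"
        "integral_translate (c \<psi>) = c \<psi> + of_int l" using integral_translate by metis
      then have "c \<phi> = c \<psi> + of_int (l + n - k)" using that by (simp add: algebra_simps)
      then show ?thesis by (rule integral_translate_cong)
    qed
    show "P e = scale (g \<phi>) e" if "\<phi> \<in> set \<phi>s" "e \<in> set (L \<phi>)" for \<phi> e
      using P(2)[of e] \<gamma>[OF that] that by auto
  qed (use basis * \<phi>s(1) in blast)+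
  show ?thesis using rs_polar_decomposition_D0[OF Q MC] by blast
qed

lemma rs_polar_decomposition_unique:
  assumes 1: "rs_polar_decomposition scale D D1 P1" and 2: "rs_polar_decomposition scale D D2 P2"
  shows "D1 = D2 \<and> P1 = P2"
proof -
  have hom: "Modules.module_hom scale scale P1" "Modules.module_hom scale scale P2"
    using 1 2 unfolding rs_polar_decomposition_def by blast+
  obtain es ds where es: "ordered_basis scale UNIV es" "jordan_chain scale D es ds"
    "\<And>i. i < length es \<Longrightarrow>
      \<exists>c. \<exists>g\<in>xinv_Rxinv. ds ! i = fls_const c + g \<and> P1 (es ! i) = scale g (es ! i)"
    using rs_polar_decomposition_chain[OF 1] by metis
  obtain es' ds' where es': "ordered_basis scale UNIV es'" "jordan_chain scale D es' ds'"
    "\<And>i. i < length es' \<Longrightarrow>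
      \<exists>c. \<exists>g\<in>xinv_Rxinv. ds' ! i = fls_const c + g \<and> P2 (es' ! i) = scale g (es' ! i)"
    using rs_polar_decomposition_chain[OF 2] by metis
  have P: "P1 = P2" by (rule polar_part_unique[OF hom es(1,2) es'(1,2) es(3) es'(3)])
  have "D v = D1 v + P1 v" "D v = D2 v + P2 v" for v
    using conjunct1[OF 1[unfolded rs_polar_decomposition_def]]
      conjunct1[OF 2[unfolded rs_polar_decomposition_def]] by simp_all
  then have "D1 v = D2 v" for v unfolding P by (metis add_right_cancel)
  then have "D1 = D2" by (rule ext)
  with P show ?thesis by blast
qed

end

theorem theorem4p11:
  fixes scale :: "'c::{alg_closed_field, field_char_0} fps fls \<Rightarrow> 'e::ab_group_add \<Rightarrow> 'e"
    and nabla :: "'e \<Rightarrow> 'e"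
  assumes "MC_tf scale nabla"
    and "admits_TLJ_form scale nabla"
  shows "\<exists>!(nabla_rs, P).
    (\<forall>v. nabla v = nabla_rs v + P v) \<and>
    MC_rs scale nabla_rs \<and> admits_TLJ_form scale nabla_rs \<and>
    Modules.module_hom scale scale P \<and> diagonalizable_end scale P \<and>
    (\<forall>c. eigenvalue_end scale P c \<longrightarrow> c \<in> xinv_Rxinv) \<and>
    (\<forall>\<Sigma> E. TLJ_form scale nabla_rs \<Sigma> E \<longrightarrow>
       \<Sigma> \<subseteq> const_characters \<and>
       (\<forall>\<rho>\<in>\<Sigma>. P ` E \<rho> \<subseteq> E \<rho> \<and>
          (\<exists>es c fs rs. joint_Jflat_form scale nabla_rs nabla (E \<rho>) es c fs rs)))"
proof -
  have MC: "MC scale nabla" using assms(1) by (simp add: MC_tf_def)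
  interpret theta_connection scale nabla
    using MC unfolding MC_def
    by (simp add: theta_connection_def theta_connection_axioms_def laurent_module_def)
  have Q: "(of_nat n :: 'c fps) dvd 1" if "n > 0" for n
  proof
    show "1 = (of_nat n :: 'c fps) * fps_const (1 / of_nat n)"
      using that by (simp add: fps_of_nat[symmetric] del: fps_of_nat)
  qed
  obtain \<Phi> E where "TLJ_form scale nabla \<Phi> E" using assms(2) unfolding admits_TLJ_form_def by blast
  from rs_polar_decomposition_exists[OF Q MC this]
  obtain D0 P where ex: "rs_polar_decomposition scale nabla D0 P" by blast
  have "\<exists>!(nabla_rs, P). rs_polar_decomposition scale nabla nabla_rs P"
  proof (rule ex1I[of _ "(D0, P)"])
    show "case (D0, P) of (nabla_rs, P) \<Rightarrow> rs_polar_decomposition scale nabla nabla_rs P"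
      using ex by simp
    fix x assume "case x of (nabla_rs, P) \<Rightarrow> rs_polar_decomposition scale nabla nabla_rs P"
    then show "x = (D0, P)" using rs_polar_decomposition_unique[OF _ ex] by (cases x) simp
  qed
  then show ?thesis unfolding rs_polar_decomposition_def .
qed

end
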